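(* Fix an integer $t\ge 1$ and a linear order $\prec$ on $T=\{1,\dots,t\}$. For every $f'\in H^{t+1}(\mathbf c)$ and every $k\in\{1,2,\dots,t+1\}$ there exists $f\in H^{t+1}_k(\mathbf c)$ such that the pair $(f,f')$ satisfies condition $S$, namely: if $f'\in H_j$, there exist $n\ge 1$, $u_1,\dots,u_{n-1}\in T$ and $v_1,\dots,v_n\in\hat T$ with $v_1=j$ and $v_n=k$ such that $$f'-f=\sum_{i=1}^{n-1}c_{u_i}\,(r^{v_i}-r^{v_{i+1}})$$ (an identity of polynomials in the indeterminates $c_i,m^i$) and the $c_{u_i}$ are increasing, i.e. $u_1\prec u_2\prec\dots\prec u_{n-1}$.
   Context: Put $T=\{1,\dots,t\}$, $\hat T=\{1,\dots,t+1\}$. Diagrams. A diagram (of order $t+1$) is a tuple $(h_1,\dots,h_{t+1})$ of non-negative integers, pictured as columns $C_1,\dots,C_{t+1}$ of unit blocks on the $x$-axis; $\mathrm{ht}\,C_i=h_i$, $B(i,j)$ ($1\le j\le h_i$) is the block of $C_i$ at level (row) $j$, $R_j$ is the set of blocks at level $j$, and the height of the diagram is $\max_i h_i$. Two distinct columns of height $\ge s$ are neighbours at level $s$ if every column strictly between them has height $<s$. A column $C$ is left (resp. right) extremal if it has no neighbour to its left (resp. right) at level $\mathrm{ht}\,C$. Boundary conditions: every left extremal column has even height or height equal to the height of the diagram, and every right extremal column has odd height or height equal to the height of the diagram. All diagrams are required to satisfy these. Moves. (1) Domino adjunction: adding two blocks on top of a column of height $i$; the domino is even/odd as $i$ is even/odd,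 and left (resp. right) if in the new diagram the enlarged column is the left (resp. right) neighbour at levels $i+1$ and $i+2$ of some column of height $\ge i+2$. Only left even and right odd dominoes may be adjoined or (inversely) removed. (2) The strongly extremal column of a non-empty diagram of height $r$ is the leftmost column of height $r$ if $r$ is odd and the rightmost column of height $r$ if $r$ is even; for the empty diagram it is $C_{t+1}$. Half-domino adjunction adds one block on top of the strongly extremal column (and its inverse removes it). (3) Row cancellation: if adjacent rows $R_{i+1},R_{i+2}$ ($i\ge0$) have the same number of blocks, delete the blocks at levels $i+1,i+2$ from every column of height $\ge i+2$ (lowering higher blocks); and the inverse. Diagrams related by a finite sequence of these moves are equivalent. A diagram is complete if no left even or right odd domino can be adjoined. The $x$-coordinate of the strongly extremal column is constant on equivalence classes; $H=H^{t+1}$ is the set of equivalence classes and $H_j$ ($j\in\hat T$) the set of classes whose strongly extremal column is $C_j$. Tableaux. Each diagram carries entries in $T$: at each non-empty level $j$ the extremal block of $R_j$ is its rightmost block if $j$ is odd and its leftmost block if $j$ is even; extremal blocks get no entry. For non-extremal $B(i,1)$ put $b(i,1)=i$; inductively for $j\ge1$, if $B(i,j+1)$ is non-extremal, $b(i,j+1)=b(k,j)$ where $C_k$ is the left (if $j$ odd) resp. right (if $j$ even) neighbour of $C_i$ at level $j$. Convention: $b(i,0)=i-1$. Functions. $c_1,\dots,c_t,m^1,\dots,m^{t+1}$ are indeterminates. For $i<j$ in $\hat T$, $r^i-r^j:=m^i+2m^{i+1}+\dots+2m^{j-1}+m^j$, $r^j-r^i:=-(r^i-r^j)$, $r^i-r^i:=0$.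 Let $h=-\sum_{i\in T}c_im^i$. For a tableau $\mathcal T$ and level $s$ let $u_1<\dots<u_k$ index the columns of height $\ge s$; $f_{R_s}=\sum_{i=1}^{k-1}c_{b(u_i,s)}(r^{u_i}-r^{u_{i+1}})$ for $s$ odd, $f_{R_s}=\sum_{i=2}^{k}c_{b(u_i,s)}(r^{u_i}-r^{u_{i-1}})$ for $s$ even, and $f_{\mathcal T}=h+\sum_{s\ge1}f_{R_s}$. $f_{\mathcal T}$ depends only on the equivalence class, and each class in $H$ is identified with this function. Order. For a tableau with heights $h_i$, $P(\mathcal T)$ is the set of relations $a<b$ in $T$ given, for each level $1\le j\le$ height, by: (a) $j$ even: for each column $C_q$ with a left neighbour $C_p$ at level $j$, letting $C_{q'}$ be the left neighbour of $C_q$ at level $j-1$: $b(q,j)<b(l,j-1)$ for every $l\ne q'$ with $l=p$ or ($p<l<q$ and $h_l=j-1$). (b) $j$ odd: for each column $C_p$ with a right neighbour $C_q$ at level $j$, letting $C_{p'}$ be the right neighbour of $C_p$ at level $j-1$: $b(p,j)<b(l,j-1)$ for every $l\ne p'$ with $l=q$ or ($p<l<q$ and $h_l=j-1$). A linear order $\prec$ on $T$ (encoding $c_a<c_b$ for $a\prec b$) is compatible with $\mathcal T$ if $a\prec b$ for each relation $a<b$ of $P(\mathcal T)$. $H^{t+1}(\mathbf c)$ is the set of classes containing a complete tableau compatible with $\prec$, and $H^{t+1}_k(\mathbf c)=H_k\cap H^{t+1}(\mathbf c)$. *)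

theory Defs
  imports Main "HOL-Library.Poly_Mapping"
begin

section \<open>Diagrams\<close>

text \<open>
  A diagram of order \<open>t + 1\<close> is encoded by its height function \<open>h\<close>, where \<open>h i\<close> is the height of
  the column \<open>C\<^sub>i\<close> for \<open>1 \<le> i \<le> t + 1\<close>. The height function is \<open>0\<close> at all other arguments, so
  that distinct functions are distinct diagrams. The block \<open>B(i,j)\<close> is the pair of \<open>i\<close> and \<open>j\<close>,
  and a row is given by the set of indices of the columns that meet it.
\<close>

abbreviation T :: "nat \<Rightarrow> nat set" where
  "T t \<equiv> {1..t}"

abbreviation That :: "nat \<Rightarrow> nat set" where
  "That t \<equiv> {1..t + 1}"

definition height :: "nat \<Rightarrow> (nat \<Rightarrow> nat) \<Rightarrow> nat" where
  "height t h = Max (h ` That t)"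

definition row :: "nat \<Rightarrow> (nat \<Rightarrow> nat) \<Rightarrow> nat \<Rightarrow> nat set" where
  "row t h s = {i \<in> That t. s \<le> h i}"

definition neighbours :: "nat \<Rightarrow> (nat \<Rightarrow> nat) \<Rightarrow> nat \<Rightarrow> nat \<Rightarrow> nat \<Rightarrow> bool" where
  "neighbours t h s p q \<longleftrightarrow>
     p \<in> That t \<and> q \<in> That t \<and> p \<noteq> q \<and> s \<le> h p \<and> s \<le> h q \<and>
     (\<forall>l. p < l \<and> l < q \<or> q < l \<and> l < p \<longrightarrow> h l < s)"

text \<open>Here \<open>C\<^sub>p\<close> is the left (right) neighbour of \<open>C\<^sub>q\<close> at level \<open>s\<close>, in this order of arguments.\<close>

definition left_neighbour :: "nat \<Rightarrow> (nat \<Rightarrow> nat) \<Rightarrow> nat \<Rightarrow> nat \<Rightarrow> nat \<Rightarrow> bool" where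
  "left_neighbour t h s p q \<longleftrightarrow> neighbours t h s p q \<and> p < q"

definition right_neighbour :: "nat \<Rightarrow> (nat \<Rightarrow> nat) \<Rightarrow> nat \<Rightarrow> nat \<Rightarrow> nat \<Rightarrow> bool" where
  "right_neighbour t h s p q \<longleftrightarrow> neighbours t h s p q \<and> q < p"

definition left_extremal :: "nat \<Rightarrow> (nat \<Rightarrow> nat) \<Rightarrow> nat \<Rightarrow> bool" where
  "left_extremal t h i \<longleftrightarrow> i \<in> That t \<and> (\<nexists>p. left_neighbour t h (h i) p i)"

definition right_extremal :: "nat \<Rightarrow> (nat \<Rightarrow> nat) \<Rightarrow> nat \<Rightarrow> bool" where
  "right_extremal t h i \<longleftrightarrow> i \<in> That t \<and> (\<nexists>p. right_neighbour t h (h i) p i)"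

definition diagram :: "nat \<Rightarrow> (nat \<Rightarrow> nat) \<Rightarrow> bool" where
  "diagram t h \<longleftrightarrow>
     (\<forall>i. i \<notin> That t \<longrightarrow> h i = 0) \<and>
     (\<forall>i. left_extremal t h i \<longrightarrow> even (h i) \<or> h i = height t h) \<and>
     (\<forall>i. right_extremal t h i \<longrightarrow> odd (h i) \<or> h i = height t h)"


section \<open>Moves and equivalence\<close>

definition left_domino :: "nat \<Rightarrow> (nat \<Rightarrow> nat) \<Rightarrow> nat \<Rightarrow> bool" where
  "left_domino t h p \<longleftrightarrow>
     (let i = h p; h' = h(p := i + 2) in
       \<exists>q. i + 2 \<le> h' q \<and> left_neighbour t h' (i + 1) p q \<and> left_neighbour t h' (i + 2) p q)"

definition right_domino :: "nat \<Rightarrow> (nat \<Rightarrow> nat) \<Rightarrow> nat \<Rightarrow> bool" where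
  "right_domino t h p \<longleftrightarrow>
     (let i = h p; h' = h(p := i + 2) in
       \<exists>q. i + 2 \<le> h' q \<and> right_neighbour t h' (i + 1) p q \<and> right_neighbour t h' (i + 2) p q)"

definition adjoinable :: "nat \<Rightarrow> (nat \<Rightarrow> nat) \<Rightarrow> nat \<Rightarrow> bool" where
  "adjoinable t h p \<longleftrightarrow>
     p \<in> That t \<and> (even (h p) \<and> left_domino t h p \<or> odd (h p) \<and> right_domino t h p)"

definition domino_move :: "nat \<Rightarrow> (nat \<Rightarrow> nat) \<Rightarrow> (nat \<Rightarrow> nat) \<Rightarrow> bool" where
  "domino_move t h h' \<longleftrightarrow> (\<exists>p. adjoinable t h p \<and> h' = h(p := h p + 2))"

text \<open>For the empty diagram the following yields \<open>C\<^sub>t\<^sub>+\<^sub>1\<close>, since its height \<open>0\<close> is even.\<close>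

definition strongly_extremal :: "nat \<Rightarrow> (nat \<Rightarrow> nat) \<Rightarrow> nat" where
  "strongly_extremal t h =
     (let I = {i \<in> That t. h i = height t h} in if odd (height t h) then Min I else Max I)"

definition half_domino_move :: "nat \<Rightarrow> (nat \<Rightarrow> nat) \<Rightarrow> (nat \<Rightarrow> nat) \<Rightarrow> bool" where
  "half_domino_move t h h' \<longleftrightarrow>
     h' = h(strongly_extremal t h := h (strongly_extremal t h) + 1)"

definition row_cancellation :: "nat \<Rightarrow> (nat \<Rightarrow> nat) \<Rightarrow> (nat \<Rightarrow> nat) \<Rightarrow> bool" where
  "row_cancellation t h h' \<longleftrightarrow>
     (\<exists>i. card (row t h (i + 1)) = card (row t h (i + 2)) \<and>
          h' = (\<lambda>p. if i + 2 \<le> h p then h p - 2 else h p))"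

definition move :: "nat \<Rightarrow> (nat \<Rightarrow> nat) \<Rightarrow> (nat \<Rightarrow> nat) \<Rightarrow> bool" where
  "move t h h' \<longleftrightarrow> diagram t h \<and> diagram t h' \<and>
     (domino_move t h h' \<or> half_domino_move t h h' \<or> row_cancellation t h h')"

text \<open>
  \<^const>\<open>equivclp\<close> closes a relation under reflexivity, symmetry and transitivity; symmetry accounts
  for the inverse moves.
\<close>

definition diagram_equiv :: "nat \<Rightarrow> ((nat \<Rightarrow> nat) \<times> (nat \<Rightarrow> nat)) set" where
  "diagram_equiv t = {(h, h'). diagram t h \<and> diagram t h' \<and> equivclp (move t) h h'}"

definition complete :: "nat \<Rightarrow> (nat \<Rightarrow> nat) \<Rightarrow> bool" where
  "complete t h \<longleftrightarrow> diagram t h \<and> (\<nexists>p. adjoinable t h p)"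

definition H :: "nat \<Rightarrow> (nat \<Rightarrow> nat) set set" where
  "H t = {h. diagram t h} // diagram_equiv t"

text \<open>
  The strongly extremal column is constant on an equivalence class \<open>F\<close>, and \<^const>\<open>the_elem\<close>
  extracts the common value.
\<close>

definition H_at :: "nat \<Rightarrow> nat \<Rightarrow> (nat \<Rightarrow> nat) set set" where
  "H_at t j = {F \<in> H t. the_elem (strongly_extremal t ` F) = j}"


section \<open>Tableaux\<close>

text \<open>
  \<open>entry t h i j\<close> is \<open>b(i,j)\<close>. It is meaningful only for \<open>j = 0\<close> and for non-extremal blocks
  \<open>B(i,j)\<close>; for the latter with \<open>j \<ge> 2\<close> the neighbour in the recursion exists and is unique.
  The entries are determined by the diagram, so a tableau is represented by its diagram.
\<close>

fun entry :: "nat \<Rightarrow> (nat \<Rightarrow> nat) \<Rightarrow> nat \<Rightarrow> nat \<Rightarrow> nat" where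
  "entry t h i 0 = i - 1"
| "entry t h i (Suc 0) = i"
| "entry t h i (Suc (Suc j)) =
     entry t h
       (THE k. if odd (Suc j) then left_neighbour t h (Suc j) k i
               else right_neighbour t h (Suc j) k i)
       (Suc j)"


section \<open>The functions attached to tableaux\<close>

datatype indeterminate = C_indet nat | M_indet nat

text \<open>
  Polynomials with integer coefficients in the indeterminates; a monomial is a finitely supported
  map from indeterminates to exponents.
\<close>

type_synonym polynomial = "(indeterminate \<Rightarrow>\<^sub>0 nat) \<Rightarrow>\<^sub>0 int"

definition indet :: "indeterminate \<Rightarrow> polynomial" where
  "indet x = Poly_Mapping.single (Poly_Mapping.single x 1) 1"

abbreviation c :: "nat \<Rightarrow> polynomial" where
  "c i \<equiv> indet (C_indet i)"

abbreviation m :: "nat \<Rightarrow> polynomial" where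
  "m i \<equiv> indet (M_indet i)"

text \<open>\<open>r_diff i j\<close> is \<open>r\<^sup>i - r\<^sup>j\<close>.\<close>

definition r_diff :: "nat \<Rightarrow> nat \<Rightarrow> polynomial" where
  "r_diff i j =
     (if i < j then m i + 2 * (\<Sum>l\<in>{i<..<j}. m l) + m j
      else if j < i then - (m j + 2 * (\<Sum>l\<in>{j<..<i}. m l) + m i)
      else 0)"

text \<open>
  The list \<open>u\<close> enumerates the columns of height at least \<open>s\<close> from left to right; as list positions
  start at \<open>0\<close>, the entry \<open>u ! (i - 1)\<close> is \<open>u\<^sub>i\<close>.
\<close>

definition row_function :: "nat \<Rightarrow> (nat \<Rightarrow> nat) \<Rightarrow> nat \<Rightarrow> polynomial" where
  "row_function t h s =
     (let u = sorted_list_of_set (row t h s); k = length u in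
      if odd s
      then \<Sum>i\<in>{1..<k}. c (entry t h (u ! (i - 1)) s) * r_diff (u ! (i - 1)) (u ! i)
      else \<Sum>i\<in>{2..k}. c (entry t h (u ! (i - 1)) s) * r_diff (u ! (i - 1)) (u ! (i - 2)))"

definition tableau_function :: "nat \<Rightarrow> (nat \<Rightarrow> nat) \<Rightarrow> polynomial" where
  "tableau_function t h =
     - (\<Sum>i\<in>T t. c i * m i) + (\<Sum>s\<in>{1..height t h}. row_function t h s)"

text \<open>The function is constant on an equivalence class.\<close>

definition class_function :: "nat \<Rightarrow> (nat \<Rightarrow> nat) set \<Rightarrow> polynomial" where
  "class_function t F = the_elem (tableau_function t ` F)"


section \<open>Compatibility with a linear order\<close>

text \<open>A pair \<open>(a, b)\<close> in the following set stands for the relation \<open>a < b\<close>.\<close>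

definition tableau_relations :: "nat \<Rightarrow> (nat \<Rightarrow> nat) \<Rightarrow> (nat \<times> nat) set" where
  "tableau_relations t h =
     {(entry t h q j, entry t h l (j - 1)) | j p q q' l.
        1 \<le> j \<and> j \<le> height t h \<and> even j \<and>
        left_neighbour t h j p q \<and> left_neighbour t h (j - 1) q' q \<and>
        l \<noteq> q' \<and> (l = p \<or> p < l \<and> l < q \<and> h l = j - 1)} \<union>
     {(entry t h p j, entry t h l (j - 1)) | j p q p' l.
        1 \<le> j \<and> j \<le> height t h \<and> odd j \<and>
        right_neighbour t h j q p \<and> right_neighbour t h (j - 1) p' p \<and>
        l \<noteq> p' \<and> (l = q \<or> p < l \<and> l < q \<and> h l = j - 1)}"

definition compatible :: "nat \<Rightarrow> (nat \<times> nat) set \<Rightarrow> (nat \<Rightarrow> nat) \<Rightarrow> bool" where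
  "compatible t prec h \<longleftrightarrow> (\<forall>(a, b) \<in> tableau_relations t h. (a, b) \<in> prec)"

definition Hc :: "nat \<Rightarrow> (nat \<times> nat) set \<Rightarrow> (nat \<Rightarrow> nat) set set" where
  "Hc t prec = {F \<in> H t. \<exists>h\<in>F. complete t h \<and> compatible t prec h}"

definition Hc_at :: "nat \<Rightarrow> (nat \<times> nat) set \<Rightarrow> nat \<Rightarrow> (nat \<Rightarrow> nat) set set" where
  "Hc_at t prec k = H_at t k \<inter> Hc t prec"

definition condition_S ::
  "nat \<Rightarrow> (nat \<times> nat) set \<Rightarrow> (nat \<Rightarrow> nat) set \<Rightarrow> (nat \<Rightarrow> nat) set \<Rightarrow> bool" where
  "condition_S t prec F F' \<longleftrightarrow>
     (\<forall>j k. F' \<in> H_at t j \<and> F \<in> H_at t k \<longrightarrow>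
       (\<exists>(n::nat) (u::nat \<Rightarrow> nat) (v::nat \<Rightarrow> nat).
          1 \<le> n \<and> (\<forall>i\<in>{1..<n}. u i \<in> T t) \<and> (\<forall>i\<in>{1..n}. v i \<in> That t) \<and>
          v 1 = j \<and> v n = k \<and>
          class_function t F' - class_function t F =
            (\<Sum>i\<in>{1..<n}. c (u i) * r_diff (v i) (v (i + 1))) \<and>
          (\<forall>i. 1 \<le> i \<and> i + 1 < n \<longrightarrow> (u i, u (i + 1)) \<in> prec)))"

end

theory Submission
  imports Defs
begin

text \<open>
  Every column but the strongly extremal one has a top label, and this matches these columns with
  \<open>T\<close>. With \<open>r\<^sup>i - r\<^sup>j = R i - R j\<close> for a potential \<open>R\<close>, the function of a tableau is a constant
  minus the sum of \<open>c\<^sub>a R(i)\<close> over the columns \<open>i\<close> with top label \<open>a\<close>. The moves preserve top labels,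
  so the theorem becomes a statement about complete compatible diagrams.

  It is proved by induction on \<open>t\<close>. Let \<open>s\<close> be the greatest label. In a compatible diagram it never
  survives a merge, so it stays between the columns \<open>s\<close> and \<open>s + 1\<close> until one of them ends: either
  column \<open>s\<close> ends at an even height or column \<open>s + 1\<close> ends at an odd height. Deleting that column gives
  a complete compatible diagram of order \<open>t\<close>, and conversely each such diagram extends in both ways.
  The two extensions have the same strongly extremal column up to the relabelling, unless it is
  column \<open>s\<close> of the smaller diagram: then they end in columns \<open>s + 1\<close> and \<open>s\<close>, and their functions
  differ by \<open>\<plusminus> c\<^sub>s (r\<^sup>s - r\<^bsup>s+1\<^esup>)\<close>. So an increasing path in order \<open>t\<close> lifts, and to reach the one
  column missed by the lift it is prolonged by a step with the greatest label \<open>s\<close>.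
\<close>


subsection \<open>Neighbours and boundary conditions\<close>

text \<open>The greatest label is the one to remove for two reasons. A merge keeps the smallest
  label, so the greatest one stays confined to a pair of adjacent columns; and a step with the
  greatest label can always be appended to an increasing path. The removed column itself has top
  label \<open>s\<close>, so it is never strongly extremal. This is why a lifted path misses exactly
  that column, and why the other extension, whose new column stands one place further, can reach it.
  Left and right obey the same rules with parities shifted by one, which would double the arguments
  on dominoes and insertions. A reflection that also shifts the levels by one interchanges the two
  cases, so only left dominoes are followed through the gaps and only columns of even height are
  inserted directly.\<close>

lemma left_neighbour_iff:
  "left_neighbour t h s p q \<longleftrightarrow>
     p \<in> That t \<and> q \<in> That t \<and> p < q \<and> s \<le> h p \<and> s \<le> h q \<and> (\<forall>l. p < l \<and> l < q \<longrightarrow> h l < s)"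
  unfolding left_neighbour_def neighbours_def by auto

lemma left_neighbourD:
  assumes "left_neighbour t h s p q"
  shows "p \<in> That t" "q \<in> That t" "p < q" "s \<le> h p" "s \<le> h q"
  using assms unfolding left_neighbour_iff by auto

lemma left_neighbour_between: "left_neighbour t h s p q \<Longrightarrow> p < l \<Longrightarrow> l < q \<Longrightarrow> h l < s"
  unfolding left_neighbour_iff by auto

lemma right_neighbour_iff: "right_neighbour t h s q p \<longleftrightarrow> left_neighbour t h s p q"
  unfolding right_neighbour_def left_neighbour_def neighbours_def by auto

lemma left_neighbour_unique_left:
  "left_neighbour t h s p q \<Longrightarrow> left_neighbour t h s p' q \<Longrightarrow> p = p'"
  unfolding left_neighbour_iff by (metis leD nat_neq_iff)

lemma left_neighbour_unique_right:
  "left_neighbour t h s p q \<Longrightarrow> left_neighbour t h s p q' \<Longrightarrow> q = q'"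
  unfolding left_neighbour_iff by (metis leD nat_neq_iff)

lemma left_neighbour_next:
  assumes "p \<in> That t" "q \<in> That t" "p < q" "s \<le> h p" "s \<le> h q"
  shows "\<exists>q' \<le> q. left_neighbour t h s p q'"
proof -
  define q' where "q' = (LEAST l. p < l \<and> s \<le> h l)"
  have "p < q' \<and> s \<le> h q'"
    unfolding q'_def by (rule LeastI[of _ q]) (use assms in auto)
  moreover have "q' \<le> q"
    unfolding q'_def by (rule Least_le) (use assms in auto)
  moreover have "h l < s" if "p < l" "l < q'" for l
    using not_less_Least[of l "\<lambda>l. p < l \<and> s \<le> h l"] that unfolding q'_def by auto
  ultimately show ?thesis
    using assms unfolding left_neighbour_iff by (intro exI[of _ q']) auto
qed

lemma left_neighbour_previous:
  assumes "p \<in> That t" "q \<in> That t" "p < q" "s \<le> h p" "s \<le> h q"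
  shows "\<exists>p' \<ge> p. left_neighbour t h s p' q"
proof -
  define S where "S = {l. p \<le> l \<and> l < q \<and> s \<le> h l}"
  have S: "finite S" "p \<in> S"
    unfolding S_def using assms by auto
  define p' where "p' = Max S"
  have "p' \<in> S"
    unfolding p'_def using S by (intro Max_in) auto
  moreover have "h l < s" if "p' < l" "l < q" for l
  proof (rule ccontr)
    assume "\<not> h l < s"
    then have "l \<in> S"
      using that calculation unfolding S_def by auto
    then show False
      using S(1) that(1) unfolding p'_def by (simp add: leD)
  qed
  ultimately show ?thesis
    using assms unfolding left_neighbour_iff S_def by (intro exI[of _ p']) auto
qed

lemma left_extremal_iff:
  "left_extremal t h i \<longleftrightarrow> i \<in> That t \<and> (\<forall>p \<in> That t. p < i \<longrightarrow> h p < h i)"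
  using left_neighbour_previous[of _ t i "h i" h]
  unfolding left_extremal_def left_neighbour_iff by (metis leD le_refl not_less)

lemma right_extremal_iff:
  "right_extremal t h i \<longleftrightarrow> i \<in> That t \<and> (\<forall>q \<in> That t. i < q \<longrightarrow> h q < h i)"
  using left_neighbour_next[of i t _ "h i" h]
  unfolding right_extremal_def right_neighbour_iff left_neighbour_iff
  by (metis leD le_refl not_less)

lemma height_ge: "i \<in> That t \<Longrightarrow> h i \<le> height t h"
  unfolding height_def by (intro Max_ge) auto

lemma height_attained: "\<exists>i \<in> That t. h i = height t h"
proof -
  have "height t h \<in> h ` That t"
    unfolding height_def by (intro Max_in) auto
  then show ?thesis
    by auto
qed

lemma eq_height_iff: "i \<in> That t \<Longrightarrow> h i = height t h \<longleftrightarrow> (\<forall>l \<in> That t. h l \<le> h i)"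
  using height_attained[of t h] height_ge[of _ t h] by (metis le_antisym)

text \<open>Comparing with all columns instead of a maximum gives a form that can be transported
  along reflections and along the deletion of a column.\<close>

lemma diagram_iff:
  "diagram t h \<longleftrightarrow>
     (\<forall>i. i \<notin> That t \<longrightarrow> h i = 0) \<and>
     (\<forall>i \<in> That t. (\<forall>p \<in> That t. p < i \<longrightarrow> h p < h i) \<longrightarrow> even (h i) \<or> (\<forall>l \<in> That t. h l \<le> h i)) \<and>
     (\<forall>i \<in> That t. (\<forall>q \<in> That t. i < q \<longrightarrow> h q < h i) \<longrightarrow> odd (h i) \<or> (\<forall>l \<in> That t. h l \<le> h i))"
  unfolding diagram_def left_extremal_iff right_extremal_iff
  using eq_height_iff[of _ t h] by blast

text \<open>The neighbour condition at level \<open>h p + 2\<close> follows from the one at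
  \<open>h p + 1\<close>, and the raised column is never strictly between, so the old heights
  suffice.\<close>

lemma adjoinable_iff:
  assumes "diagram t h"
  shows "adjoinable t h p \<longleftrightarrow> p \<in> That t \<and>
     (even (h p) \<and> (\<exists>q > p. h p + 2 \<le> h q \<and> (\<forall>l. p < l \<and> l < q \<longrightarrow> h l \<le> h p)) \<or>
      odd (h p) \<and> (\<exists>q < p. h p + 2 \<le> h q \<and> (\<forall>l. q < l \<and> l < p \<longrightarrow> h l \<le> h p)))"
proof -
  \<comment> \<open>Heights vanish outside the range, so a column that reaches a positive level lies
    in it.\<close>
  have *: "h q \<ge> Suc n \<Longrightarrow> q \<in> That t" for q n
    using assms unfolding diagram_def by (metis Suc_n_not_le_n le0 le_trans)
  have l: "left_domino t h p \<longleftrightarrow> (\<exists>q > p. h p + 2 \<le> h q \<and> (\<forall>l. p < l \<and> l < q \<longrightarrow> h l \<le> h p))"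
    if "p \<in> That t"
    unfolding left_domino_def Let_def
  proof (rule ex_cong1)
    fix q
    show "(h p + 2 \<le> (h(p := h p + 2)) q \<and> left_neighbour t (h(p := h p + 2)) (h p + 1) p q \<and>
        left_neighbour t (h(p := h p + 2)) (h p + 2) p q) \<longleftrightarrow>
      p < q \<and> h p + 2 \<le> h q \<and> (\<forall>l. p < l \<and> l < q \<longrightarrow> h l \<le> h p)"
      using that *[of "h p + 1" q] by (cases "p < q") (auto simp: left_neighbour_iff less_Suc_eq_le le_SucI)
  qed
  have r: "right_domino t h p \<longleftrightarrow> (\<exists>q < p. h p + 2 \<le> h q \<and> (\<forall>l. q < l \<and> l < p \<longrightarrow> h l \<le> h p))"
    if "p \<in> That t"
    unfolding right_domino_def Let_def right_neighbour_iff
  proof (rule ex_cong1)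
    fix q
    show "(h p + 2 \<le> (h(p := h p + 2)) q \<and> left_neighbour t (h(p := h p + 2)) (h p + 1) q p \<and>
        left_neighbour t (h(p := h p + 2)) (h p + 2) q p) \<longleftrightarrow>
      q < p \<and> h p + 2 \<le> h q \<and> (\<forall>l. q < l \<and> l < p \<longrightarrow> h l \<le> h p)"
      using that *[of "h p + 1" q] by (cases "q < p") (auto simp: left_neighbour_iff less_Suc_eq_le le_SucI)
  qed
  show ?thesis
    unfolding adjoinable_def using l r by blast
qed


lemma adjoinable_even:
  "diagram t h \<Longrightarrow> adjoinable t h p \<Longrightarrow> even (h p) \<Longrightarrow>
     \<exists>q > p. h p + 2 \<le> h q \<and> (\<forall>l. p < l \<and> l < q \<longrightarrow> h l \<le> h p)"
  by (simp add: adjoinable_iff)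

lemma adjoinable_odd:
  "diagram t h \<Longrightarrow> adjoinable t h p \<Longrightarrow> odd (h p) \<Longrightarrow>
     \<exists>q < p. h p + 2 \<le> h q \<and> (\<forall>l. q < l \<and> l < p \<longrightarrow> h l \<le> h p)"
  by (simp add: adjoinable_iff)


subsection \<open>Gaps and their labels\<close>

text \<open>
  An entry in row \<open>j\<close> is regarded as the label of the gap between two neighbours \<open>C\<^sub>p\<close>, \<open>C\<^sub>q\<close> at level
  \<open>j\<close>, read off from \<open>C\<^sub>p\<close> if \<open>j\<close> is odd and from \<open>C\<^sub>q\<close> if \<open>j\<close> is even. When columns end at level
  \<open>j\<close>, adjacent gaps merge, and the merged gap inherits the label of its leftmost (\<open>j\<close> even) or
  rightmost (\<open>j\<close> odd) part.
\<close>

inductive gap :: "nat \<Rightarrow> (nat \<Rightarrow> nat) \<Rightarrow> nat \<Rightarrow> nat \<Rightarrow> nat \<Rightarrow> nat \<Rightarrow> bool" for t h where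
  base: "p \<in> T t \<Longrightarrow> gap t h 0 p (Suc p) p"
| even: "gap t h j p q' a \<Longrightarrow> even j \<Longrightarrow> left_neighbour t h (Suc j) p q \<Longrightarrow> gap t h (Suc j) p q a"
| odd: "gap t h j p' q a \<Longrightarrow> odd j \<Longrightarrow> left_neighbour t h (Suc j) p q \<Longrightarrow> gap t h (Suc j) p q a"

inductive_cases gap_SucE: "gap t h (Suc j) p q a"
inductive_cases gap_0E: "gap t h 0 p q a"

lemma gap_left_neighbour: "gap t h j p q a \<Longrightarrow> left_neighbour t h j p q"
  by (induction rule: gap.induct) (auto simp: left_neighbour_iff)

lemma gap_label: "gap t h j p q a \<Longrightarrow> a \<in> T t"
  by (induction rule: gap.induct) auto

text \<open>The conclusion of each rule determines its premise: neighbours are unique, and one end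
  of the gap (left for even \<open>j\<close>, right for odd \<open>j\<close>) is kept.\<close>

lemma gap_unique: "gap t h j p q a \<Longrightarrow> gap t h j p q b \<Longrightarrow> a = b"
proof (induction j arbitrary: p q)
  case 0
  then show ?case by (auto elim!: gap_0E)
next
  case (Suc j)
  show ?case
  proof (cases "even j")
    case True
    then obtain q1 q2 where "gap t h j p q1 a" "gap t h j p q2 b"
      using Suc.prems by (auto elim!: gap_SucE)
    then show ?thesis
      using Suc.IH gap_left_neighbour left_neighbour_unique_right by metis
  next
    case False
    then obtain p1 p2 where "gap t h j p1 q a" "gap t h j p2 q b"
      using Suc.prems by (auto elim!: gap_SucE)
    then show ?thesis
      using Suc.IH gap_left_neighbour left_neighbour_unique_left by metis
  qed
qed

text \<open>Columns that reach level \<open>Suc j\<close> reach level \<open>j\<close>, so below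
  each gap there is one that shares the end prescribed by the parity.\<close>

lemma gap_exists: "left_neighbour t h j p q \<Longrightarrow> \<exists>a. gap t h j p q a"
proof (induction j arbitrary: p q)
  case 0
  then have "q = Suc p"
    unfolding left_neighbour_iff by (metis Suc_lessI lessI not_less_zero)
  moreover have "p \<in> T t"
    using 0 unfolding left_neighbour_iff by auto
  ultimately show ?case
    using gap.base by blast
next
  case (Suc j)
  have *: "p \<in> That t" "q \<in> That t" "p < q" "j \<le> h p" "j \<le> h q"
    using Suc.prems unfolding left_neighbour_iff by auto
  show ?case
  proof (cases "even j")
    case True
    obtain q' where "left_neighbour t h j p q'"
      using left_neighbour_next[OF *] by blast
    then show ?thesis
      using Suc True gap.even by blast
  next
    case False
    obtain p' where "left_neighbour t h j p' q"
      using left_neighbour_previous[OF *] by blast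
    then show ?thesis
      using Suc False gap.odd by blast
  qed
qed

lemma entry_gap: "gap t h j p q a \<Longrightarrow> entry t h (if odd j then p else q) j = a"
proof (induction rule: gap.induct)
  case (base p)
  then show ?case by simp
next
  case (even j p q' a q)
  show ?case
  proof (cases j)
    \<comment> \<open>Level 1 is a base case of \<open>entry\<close>; it agrees because the gap at
      level 0 that starts at column \<open>p\<close> is labelled \<open>p\<close>.\<close>
    case 0
    then show ?thesis using even by (auto elim: gap_0E)
  next
    case (Suc j')
    have "(THE k. right_neighbour t h j k p) = q'"
      unfolding right_neighbour_iff using gap_left_neighbour[OF even.hyps(1)]
      by (blast intro: left_neighbour_unique_right the_equality)
    then show ?thesis using even Suc by auto
  qed
next
  case (odd j p' q a p)
  obtain j' where j': "j = Suc j'"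
    using odd by (cases j) auto
  have "(THE k. left_neighbour t h j k q) = p'"
    using gap_left_neighbour[OF odd.hyps(1)]
    by (blast intro: left_neighbour_unique_left the_equality)
  then show ?case using odd j' by auto
qed

text \<open>Compatibility: among merging gaps, the surviving label is the smallest one.\<close>

lemma compatible_iff:
  "compatible t prec h \<longleftrightarrow>
     (\<forall>j p q a l l' b. gap t h (Suc j) p q a \<and> gap t h j l l' b \<and> p \<le> l \<and> l' \<le> q \<and>
        \<not> (if even j then l = p else l' = q) \<longrightarrow> (a, b) \<in> prec)" (is "?L \<longleftrightarrow> ?R")
proof
  assume L: ?L
  show ?R
  proof (intro allI impI, elim conjE)
    fix j p q a l l' b
    assume a: "gap t h (Suc j) p q a" and b: "gap t h j l l' b" and le: "p \<le> l" "l' \<le> q"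
      and ne: "\<not> (if even j then l = p else l' = q)"
    have pq: "left_neighbour t h (Suc j) p q" and ll: "left_neighbour t h j l l'"
      using a b by (auto dest: gap_left_neighbour)
    have height: "Suc j \<le> height t h"
      using pq height_ge[of p t h] unfolding left_neighbour_iff by auto
    show "(a, b) \<in> prec"
    proof (cases "even j")
      case True
      then obtain q' where q': "left_neighbour t h j p q'"
        using a by (auto elim!: gap_SucE dest: gap_left_neighbour)
      have "l' \<noteq> q'"
        using q' ll ne True left_neighbour_unique_left by metis
      \<comment> \<open>A column strictly inside the larger gap does not reach level
        \<open>Suc j\<close>, so its height is exactly \<open>j\<close>, as the defining relations
        demand.\<close>
      moreover have "l' = q \<or> p < l' \<and> l' < q \<and> h l' = j"
        using left_neighbour_between[OF pq, of l'] left_neighbourD[OF ll] le by linarith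
      moreover have "a = entry t h p (Suc j)" "b = entry t h l' j"
        using entry_gap[OF a] entry_gap[OF b] True by auto
      ultimately have "(a, b) \<in> tableau_relations t h"
        unfolding tableau_relations_def using pq q' height True
        by - (rule UnI2, rule CollectI, rule exI[of _ "Suc j"], rule exI[of _ p], rule exI[of _ q],
            rule exI[of _ q'], rule exI[of _ l'], simp add: right_neighbour_iff)
      then show ?thesis using L unfolding compatible_def by auto
    next
      case False
      then obtain q' where q': "left_neighbour t h j q' q"
        using a by (auto elim!: gap_SucE dest: gap_left_neighbour)
      have "l \<noteq> q'"
        using q' ll ne False left_neighbour_unique_right by metis
      moreover have "l = p \<or> p < l \<and> l < q \<and> h l = j"
        using left_neighbour_between[OF pq, of l] left_neighbourD[OF ll] le by linarith
      moreover have "a = entry t h q (Suc j)" "b = entry t h l j"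
        using entry_gap[OF a] entry_gap[OF b] False by auto
      ultimately have "(a, b) \<in> tableau_relations t h"
        unfolding tableau_relations_def using pq q' height False
        by - (rule UnI1, rule CollectI, rule exI[of _ "Suc j"], rule exI[of _ p], rule exI[of _ q],
            rule exI[of _ q'], rule exI[of _ l], simp)
      then show ?thesis using L unfolding compatible_def by auto
    qed
  qed
next
  assume R: ?R
  have "(entry t h q j, entry t h l (j - 1)) \<in> prec"
    if as: "1 \<le> j" "even j" "left_neighbour t h j p q" "left_neighbour t h (j - 1) q' q"
      "l \<noteq> q'" "l = p \<or> p < l \<and> l < q \<and> h l = j - 1" for j p q q' l
  proof -
    obtain i where i: "j = Suc i" using as(1) by (cases j) auto
    have "l \<in> That t" "q \<in> That t" "l < q" "i \<le> h l" "i \<le> h q"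
      using as i unfolding left_neighbour_iff by auto
    \<comment> \<open>At the odd level \<open>i\<close> the entry of column \<open>l\<close> labels
      the gap to its right, so the right end of that gap has to be found.\<close>
    then obtain l' where l': "l' \<le> q" "left_neighbour t h i l l'"
      using left_neighbour_next by blast
    then have "l' \<noteq> q" using as i left_neighbour_unique_left by auto
    obtain a b where ab: "gap t h (Suc i) p q a" "gap t h i l l' b"
      using gap_exists as l' i by blast
    have "(a, b) \<in> prec" using R ab l' \<open>l' \<noteq> q\<close> as(2,6) i by (metis even_Suc le_refl less_imp_le)
    then show ?thesis using entry_gap[OF ab(1)] entry_gap[OF ab(2)] as(2) i by auto
  qed
  moreover have "(entry t h p j, entry t h l (j - 1)) \<in> prec"
    if as: "1 \<le> j" "odd j" "left_neighbour t h j p q" "left_neighbour t h (j - 1) p p'"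
      "l \<noteq> p'" "l = q \<or> p < l \<and> l < q \<and> h l = j - 1" for j p q p' l
  proof -
    obtain i where i: "j = Suc i" using as(1) by (cases j) auto
    have "p \<in> That t" "l \<in> That t" "p < l" "i \<le> h p" "i \<le> h l"
      using as i unfolding left_neighbour_iff by auto
    then obtain k where k: "p \<le> k" "left_neighbour t h i k l"
      using left_neighbour_previous by blast
    then have "k \<noteq> p" using as i left_neighbour_unique_right by auto
    obtain a b where ab: "gap t h (Suc i) p q a" "gap t h i k l b"
      using gap_exists as k i by blast
    have "(a, b) \<in> prec" using R ab k \<open>k \<noteq> p\<close> as(2,6) i by (metis even_Suc le_refl less_imp_le)
    then show ?thesis using entry_gap[OF ab(1)] entry_gap[OF ab(2)] as(2) i by auto
  qed
  ultimately show ?L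
    unfolding compatible_def tableau_relations_def right_neighbour_iff by auto
qed

text \<open>
  The top label of a column is the label that disappears when the column ends. Only the strongly
  extremal column has none.
\<close>

definition top_label :: "nat \<Rightarrow> (nat \<Rightarrow> nat) \<Rightarrow> nat \<Rightarrow> nat \<Rightarrow> bool" where
  "top_label t h i a \<longleftrightarrow> (if even (h i) then \<exists>q. gap t h (h i) i q a else \<exists>p. gap t h (h i) p i a)"

lemma top_label_in: "top_label t h i a \<Longrightarrow> i \<in> That t \<and> a \<in> T t"
  unfolding top_label_def left_neighbour_iff
  using gap_label gap_left_neighbour[unfolded left_neighbour_iff] by meson

lemma gap_unique_right: "gap t h j p q a \<Longrightarrow> gap t h j p q' b \<Longrightarrow> a = b"
  using gap_unique gap_left_neighbour left_neighbour_unique_right by metis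

lemma gap_unique_left: "gap t h j p q a \<Longrightarrow> gap t h j p' q b \<Longrightarrow> a = b"
  using gap_unique gap_left_neighbour left_neighbour_unique_left by metis

lemma top_label_unique: "top_label t h i a \<Longrightarrow> top_label t h i b \<Longrightarrow> a = b"
  unfolding top_label_def using gap_unique_right gap_unique_left by (metis (no_types))

lemma strongly_extremal_iff:
  "strongly_extremal t h = i \<longleftrightarrow> i \<in> That t \<and> h i = height t h \<and>
     (\<forall>l \<in> That t. (if odd (height t h) then l < i else i < l) \<longrightarrow> h l < h i)"
proof -
  define I where "I = {i \<in> That t. h i = height t h}"
  have "finite I" "I \<noteq> {}"
    unfolding I_def using height_attained[of t h] by auto
  then have "Min I = i \<longleftrightarrow> i \<in> I \<and> (\<forall>l \<in> I. i \<le> l)" "Max I = i \<longleftrightarrow> i \<in> I \<and> (\<forall>l \<in> I. l \<le> i)"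
    by (auto simp: Min_eq_iff Max_eq_iff)
  moreover have "l \<notin> I \<longleftrightarrow> h l < h i" if "i \<in> I" "l \<in> That t" for l
    using that height_ge[OF that(2), of h] unfolding I_def by auto
  then have "(\<forall>l \<in> I. i \<le> l) \<longleftrightarrow> (\<forall>l \<in> That t. l < i \<longrightarrow> h l < h i)"
    "(\<forall>l \<in> I. l \<le> i) \<longleftrightarrow> (\<forall>l \<in> That t. i < l \<longrightarrow> h l < h i)" if "i \<in> I"
    using that I_def by (metis (no_types, lifting) mem_Collect_eq not_le)+
  moreover have "i \<in> I \<longleftrightarrow> i \<in> That t \<and> h i = height t h"
    unfolding I_def by simp
  moreover have "strongly_extremal t h = (if odd (height t h) then Min I else Max I)"
    unfolding strongly_extremal_def I_def Let_def ..
  ultimately show ?thesis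
    by (cases "odd (height t h)") auto
qed

lemma strongly_extremal_in: "strongly_extremal t h \<in> That t"
  using strongly_extremal_iff by blast

text \<open>A column of even height has no top label iff no column to its right is as high. It is
  then right extremal of even height, so the boundary condition forces maximal height and it is the
  rightmost such column. Odd heights are symmetric.\<close>

lemma top_label_exists_iff:
  assumes "diagram t h" "i \<in> That t"
  shows "(\<exists>a. top_label t h i a) \<longleftrightarrow> i \<noteq> strongly_extremal t h"
proof -
  have "(\<exists>a. top_label t h i a) \<longleftrightarrow>
      (if even (h i) then \<exists>q \<in> That t. i < q \<and> h i \<le> h q else \<exists>p \<in> That t. p < i \<and> h i \<le> h p)"
  proof (cases "even (h i)")
    case True
    then have "(\<exists>a. top_label t h i a) \<longleftrightarrow> (\<exists>q. left_neighbour t h (h i) i q)"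
      unfolding top_label_def using gap_exists gap_left_neighbour by metis
    also have "\<dots> \<longleftrightarrow> (\<exists>q \<in> That t. i < q \<and> h i \<le> h q)"
      using assms left_neighbour_next[of i t _ "h i" h] by (meson left_neighbour_iff order_refl)
    finally show ?thesis using True by simp
  next
    case False
    then have "(\<exists>a. top_label t h i a) \<longleftrightarrow> (\<exists>p. left_neighbour t h (h i) p i)"
      unfolding top_label_def using gap_exists gap_left_neighbour by metis
    also have "\<dots> \<longleftrightarrow> (\<exists>p \<in> That t. p < i \<and> h i \<le> h p)"
      using assms left_neighbour_previous[of _ t i "h i" h] by (meson left_neighbour_iff order_refl)
    finally show ?thesis using False by simp
  qed
  moreover have "strongly_extremal t h = i \<longleftrightarrow>
    (if even (h i) then \<forall>q \<in> That t. i < q \<longrightarrow> h q < h i else \<forall>p \<in> That t. p < i \<longrightarrow> h p < h i)"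
    (is "?L \<longleftrightarrow> ?R")
  proof
    assume ?L
    then show ?R
      unfolding strongly_extremal_iff by (metis (no_types))
  next
    assume ?R
    then have "h i = height t h"
      using assms unfolding diagram_iff eq_height_iff[OF assms(2)] by metis
    then show ?L
      using \<open>?R\<close> assms(2) unfolding strongly_extremal_iff by metis
  qed
  ultimately show ?thesis
    by (metis not_less)
qed


subsection \<open>The function of a tableau\<close>

text \<open>The default 0 makes columns without a label, such as the strongly extremal one, drop out
  of the sums.\<close>

definition label_value :: "(nat \<Rightarrow> 'r::comm_ring_1) \<Rightarrow> (nat \<Rightarrow> bool) \<Rightarrow> 'r" where
  "label_value C P = (if \<exists>a. P a then C (THE a. P a) else 0)"

lemma label_value_eq: "P a \<Longrightarrow> (\<And>b. P b \<Longrightarrow> b = a) \<Longrightarrow> label_value C P = C a"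
  unfolding label_value_def by (metis the_equality)

lemma label_value_none: "\<nexists>a. P a \<Longrightarrow> label_value C P = 0"
  unfolding label_value_def by auto

text \<open>
  The coefficients \<open>C\<close> and \<open>R\<close> are kept arbitrary so that a relabelling of columns and entries is
  just an instantiation and no substitution in polynomials is needed.
\<close>

definition label_sum ::
  "nat \<Rightarrow> (nat \<Rightarrow> nat) \<Rightarrow> (nat \<Rightarrow> 'r::comm_ring_1) \<Rightarrow> (nat \<Rightarrow> 'r) \<Rightarrow> 'r" where
  "label_sum t h C R = (\<Sum>i\<in>That t. label_value C (top_label t h i) * R i)"

section \<open>Row functions as sums over columns\<close>

definition right_value :: "nat \<Rightarrow> (nat \<Rightarrow> nat) \<Rightarrow> nat \<Rightarrow> nat \<Rightarrow> polynomial" where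
  "right_value t h s i = label_value c (\<lambda>a. \<exists>q. gap t h s i q a)"

definition left_value :: "nat \<Rightarrow> (nat \<Rightarrow> nat) \<Rightarrow> nat \<Rightarrow> nat \<Rightarrow> polynomial" where
  "left_value t h s i = label_value c (\<lambda>a. \<exists>p. gap t h s p i a)"

lemma right_value_gap: "gap t h s p q a \<Longrightarrow> right_value t h s p = c a"
  unfolding right_value_def by (rule label_value_eq) (auto dest: gap_unique_right)

lemma left_value_gap: "gap t h s p q a \<Longrightarrow> left_value t h s q = c a"
  unfolding left_value_def by (rule label_value_eq) (auto dest: gap_unique_left)

lemma right_value_none: "(\<And>q. q \<in> That t \<Longrightarrow> i < q \<Longrightarrow> h q < s) \<Longrightarrow> right_value t h s i = 0"
  unfolding right_value_def
  by (rule label_value_none) (meson gap_left_neighbour left_neighbourD leD)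

lemma left_value_none: "(\<And>p. p \<in> That t \<Longrightarrow> p < i \<Longrightarrow> h p < s) \<Longrightarrow> left_value t h s i = 0"
  unfolding left_value_def
  by (rule label_value_none) (meson gap_left_neighbour left_neighbourD leD)

text \<open>Only differences are prescribed, so an additive constant is free. The terms with
  \<open>m 0\<close> cancel between any two columns.\<close>

definition potential :: "nat \<Rightarrow> polynomial" where
  "potential i = - (m i + 2 * (\<Sum>l<i. m l))"

lemma r_diff_potential: "r_diff i j = potential i - potential j"
proof -
  have *: "(\<Sum>l<j. m l) = (\<Sum>l<i. m l) + m i + (\<Sum>l\<in>{i<..<j}. m l)" if "i < j" for i j
  proof -
    have "{..<j} = insert i ({..<i} \<union> {i<..<j})"
      using that by auto
    then have "(\<Sum>l<j. m l) = m i + (\<Sum>l\<in>{..<i} \<union> {i<..<j}. m l)"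
      by simp
    also have "\<dots> = m i + ((\<Sum>l<i. m l) + (\<Sum>l\<in>{i<..<j}. m l))"
      by (subst sum.union_disjoint) auto
    finally show ?thesis by (simp add: ac_simps)
  qed
  show ?thesis
    unfolding r_diff_def potential_def using *[of i j] *[of j i]
    by (cases i j rule: linorder_cases) (auto simp: algebra_simps)
qed

text \<open>Each gap contributes its label times a difference of potentials. Splitting the
  difference lets each column collect the label on its right with a plus and the one on its left
  with a minus. In even rows entries sit at the right ends and the differences are reversed, hence
  the sign.\<close>

lemma row_function_eq:
  "row_function t h s = (if odd s then 1 else - 1) *
     (\<Sum>i\<in>row t h s. (right_value t h s i - left_value t h s i) * potential i)"
proof -
  define u where "u = sorted_list_of_set (row t h s)"
  have row: "set u = row t h s" "distinct u" "sorted_wrt (<) u"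
    unfolding u_def row_def by (auto simp: strict_sorted_list_of_set)
  have le: "u ! i < u ! j \<longleftrightarrow> i < j" if "i < length u" "j < length u" for i j
    using sorted_wrt_nth_less[OF row(3)] that by (metis nat_neq_iff order_less_asym)
  have in_row: "u ! i \<in> That t \<and> s \<le> h (u ! i)" if "i < length u" for i
    using nth_mem[OF that] unfolding row(1) row_def by simp
  have nth: "\<exists>j < length u. l = u ! j" if "l \<in> That t" "s \<le> h l" for l
    using that row(1) unfolding row_def by (metis (mono_tags, lifting) in_set_conv_nth mem_Collect_eq)
  have sum: "(\<Sum>i\<in>row t h s. g i) = (\<Sum>i<length u. g (u ! i))" for g :: "nat \<Rightarrow> polynomial"
    using sum.distinct_set_conv_list[OF row(2), of g]
    by (simp add: row(1) sum_list_sum_nth atLeast0LessThan)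
  show ?thesis
  proof (cases "length u")
    case 0
    then show ?thesis
      unfolding row_function_def u_def[symmetric] sum by simp
  next
    case (Suc k)
    have "left_neighbour t h s (u ! i) (u ! Suc i)" if i: "i < k" for i
    proof -
      have "h l < s" if l: "u ! i < l" "l < u ! Suc i" for l
      proof (rule ccontr)
        assume "\<not> h l < s"
        moreover have "l \<in> That t"
          using l in_row[of i] in_row[of "Suc i"] i Suc by auto
        ultimately obtain j where "j < length u" "l = u ! j"
          using nth by (metis not_less)
        then show False
          using l le[of i j] le[of j "Suc i"] i Suc by auto
      qed
      then show ?thesis
        unfolding left_neighbour_iff using le[of i "Suc i"] in_row[of i] in_row[of "Suc i"] i Suc by auto
    qed
    then have "\<forall>i < k. \<exists>a. gap t h s (u ! i) (u ! Suc i) a"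
      using gap_exists by blast
    then obtain a where a: "gap t h s (u ! i) (u ! Suc i) (a i)" if "i < k" for i
      by metis
    have "right_value t h s (u ! k) = 0"
    proof (rule right_value_none, rule ccontr)
      fix q assume q: "q \<in> That t" "u ! k < q" "\<not> h q < s"
      then obtain j where "j < length u" "q = u ! j"
        using nth by (metis not_less)
      then show False
        using le[of k j] q Suc by auto
    qed
    then have R: "(\<Sum>i<length u. right_value t h s (u ! i) * potential (u ! i)) =
        (\<Sum>i<k. c (a i) * potential (u ! i))"
      unfolding Suc using right_value_gap[OF a] by simp
    have "left_value t h s (u ! 0) = 0"
    proof (rule left_value_none, rule ccontr)
      fix q assume q: "q \<in> That t" "q < u ! 0" "\<not> h q < s"
      then obtain j where "j < length u" "q = u ! j"
        using nth by (metis not_less)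
      then show False
        using le[of j 0] q Suc by auto
    qed
    then have L: "(\<Sum>i<length u. left_value t h s (u ! i) * potential (u ! i)) =
        (\<Sum>i<k. c (a i) * potential (u ! Suc i))"
      unfolding Suc sum.lessThan_Suc_shift using left_value_gap[OF a] by simp
    have RL: "(\<Sum>i\<in>row t h s. (right_value t h s i - left_value t h s i) * potential i) =
        (\<Sum>i<k. c (a i) * (potential (u ! i) - potential (u ! Suc i)))"
      unfolding sum by (simp add: left_diff_distrib right_diff_distrib sum_subtractf R L)
    show ?thesis
    proof (cases "odd s")
      case True
      then have "row_function t h s =
          (\<Sum>i\<in>{1..<Suc k}. c (entry t h (u ! (i - 1)) s) * r_diff (u ! (i - 1)) (u ! i))"
        unfolding row_function_def u_def[symmetric] Let_def Suc by simp
      also have "\<dots> = (\<Sum>i<k. c (a i) * (potential (u ! i) - potential (u ! Suc i)))"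
        by (rule sum.reindex_bij_witness[of _ Suc "\<lambda>i. i - 1"])
          (use entry_gap[OF a] True in \<open>auto simp: r_diff_potential\<close>)
      finally show ?thesis using True RL by simp
    next
      case False
      then have "row_function t h s =
          (\<Sum>i\<in>{2..Suc k}. c (entry t h (u ! (i - 1)) s) * r_diff (u ! (i - 1)) (u ! (i - 2)))"
        unfolding row_function_def u_def[symmetric] Let_def Suc by simp
      also have "\<dots> = (\<Sum>i<k. c (a i) * (potential (u ! Suc i) - potential (u ! i)))"
      proof (rule sum.reindex_bij_witness[of _ "\<lambda>i. i + 2" "\<lambda>i. i - 2"])
        fix i assume "i \<in> {2..Suc k}"
        then have "i - 2 < k" "Suc (i - 2) = i - 1"
          by auto
        then show "c (a (i - 2)) * (potential (u ! Suc (i - 2)) - potential (u ! (i - 2))) =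
            c (entry t h (u ! (i - 1)) s) * r_diff (u ! (i - 1)) (u ! (i - 2))"
          using entry_gap[OF a, of "i - 2"] False by (simp add: r_diff_potential)
      qed auto
      finally show ?thesis
        using False RL by (simp add: sum_negf[symmetric] algebra_simps)
    qed
  qed
qed

text \<open>The boundary conditions say that the right end of an even row and the left end of an odd row
  survive in the next row.\<close>

lemma right_column_above:
  assumes "diagram t h" "even s" "i \<in> That t" "Suc s \<le> h i" "q \<in> That t" "i < q" "s \<le> h q"
  shows "\<exists>r \<in> That t. i < r \<and> Suc s \<le> h r"
proof -
  define r where "r = Max {q \<in> That t. s \<le> h q}"
  have fin: "finite {q \<in> That t. s \<le> h q}" by simp
  have r: "r \<in> That t" "s \<le> h r"
    using Max_in[OF fin] assms(5,7) unfolding r_def by blast+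
  have r_max: "q \<le> r" if "q \<in> That t" "s \<le> h q" for q
    using Max_ge[OF fin] that unfolding r_def by blast
  have "Suc s \<le> h r"
  proof (rule ccontr)
    assume "\<not> Suc s \<le> h r"
    then have "h r = s" using r by simp
    moreover have "h q < h r" if "q \<in> That t" "r < q" for q
      using r_max[of q] that calculation by force
    ultimately have "\<forall>l \<in> That t. h l \<le> h r"
      using assms(1,2) r unfolding diagram_iff by blast
    then have "h i \<le> h r" using assms(3) by blast
    then show False using assms(4) \<open>h r = s\<close> by simp
  qed
  then show ?thesis
    using r r_max[OF assms(5,7)] assms(6) by (intro bexI[of _ r]) auto
qed

lemma left_column_above:
  assumes "diagram t h" "odd s" "i \<in> That t" "Suc s \<le> h i" "q \<in> That t" "q < i" "s \<le> h q"
  shows "\<exists>r \<in> That t. r < i \<and> Suc s \<le> h r"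
proof -
  define r where "r = Min {q \<in> That t. s \<le> h q}"
  have fin: "finite {q \<in> That t. s \<le> h q}" by simp
  have r: "r \<in> That t" "s \<le> h r"
    using Min_in[OF fin] assms(5,7) unfolding r_def by blast+
  have r_min: "r \<le> q" if "q \<in> That t" "s \<le> h q" for q
    using Min_le[OF fin] that unfolding r_def by blast
  have "Suc s \<le> h r"
  proof (rule ccontr)
    assume "\<not> Suc s \<le> h r"
    then have "h r = s" using r by simp
    moreover have "h q < h r" if "q \<in> That t" "q < r" for q
      using r_min[of q] that calculation by force
    ultimately have "\<forall>l \<in> That t. h l \<le> h r"
      using assms(1,2) r unfolding diagram_iff by blast
    then have "h i \<le> h r" using assms(3) by blast
    then show False using assms(4) \<open>h r = s\<close> by simp
  qed
  then show ?thesis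
    using r r_min[OF assms(5,7)] assms(6) by (intro bexI[of _ r]) auto
qed

text \<open>Above an even level a label is passed on through the left end of its gap, so the label
  behind a surviving column persists. The boundary condition ensures that a gap behind it
  remains.\<close>

lemma right_value_step:
  assumes "diagram t h" "even s" "Suc s \<le> h i" "i \<in> That t"
  shows "right_value t h (Suc s) i = right_value t h s i"
proof (cases "\<exists>q \<in> That t. i < q \<and> s \<le> h q")
  case True
  then obtain r where r: "r \<in> That t" "i < r" "Suc s \<le> h r"
    using right_column_above[OF assms(1,2,4,3)] by blast
  obtain q where q: "left_neighbour t h (Suc s) i q"
    using left_neighbour_next[OF assms(4) r(1,2) assms(3) r(3)] by blast
  obtain q' where "left_neighbour t h s i q'"
    using left_neighbour_next[OF assms(4) r(1,2)] assms(3) r(3) by (meson Suc_leD)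
  then obtain a where "gap t h s i q' a"
    using gap_exists by blast
  then show ?thesis
    using gap.even[OF _ assms(2) q] right_value_gap by metis
next
  case False
  then show ?thesis
    using right_value_none[of t i h s] right_value_none[of t i h "Suc s"]
    by (metis less_SucI not_less)
qed

lemma left_value_step:
  assumes "diagram t h" "odd s" "Suc s \<le> h i" "i \<in> That t"
  shows "left_value t h (Suc s) i = left_value t h s i"
proof (cases "\<exists>q \<in> That t. q < i \<and> s \<le> h q")
  case True
  then obtain r where r: "r \<in> That t" "r < i" "Suc s \<le> h r"
    using left_column_above[OF assms(1,2,4,3)] by blast
  obtain p where p: "left_neighbour t h (Suc s) p i"
    using left_neighbour_previous[OF r(1) assms(4) r(2,3) assms(3)] by blast
  obtain p' where "left_neighbour t h s p' i"
    using left_neighbour_previous[OF r(1) assms(4) r(2)] assms(3) r(3) by (meson Suc_leD)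
  then obtain a where "gap t h s p' i a"
    using gap_exists by blast
  then show ?thesis
    using gap.odd[OF _ assms(2) p] left_value_gap by metis
next
  case False
  then show ?thesis
    using left_value_none[of t i h s] left_value_none[of t i h "Suc s"]
    by (metis less_SucI not_less)
qed

text \<open>Right labels agree on levels 2k and 2k + 1, left labels on levels 2k + 1 and 2k + 2. The
  shift between the two pairings is why level 0 survives only on the right.\<close>

lemma alternating_sum_right_value:
  assumes "diagram t h" "i \<in> That t"
  shows "e \<le> h i \<Longrightarrow> (\<Sum>s\<in>{1..e}. (if odd s then 1 else - 1) * right_value t h s i) =
    right_value t h 0 i - (if even e then right_value t h e i else 0)"
proof (induction e)
  case (Suc e)
  then show ?case
    using right_value_step[OF assms(1) _ _ assms(2), of e] by auto
qed simp

lemma alternating_sum_left_value: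
  assumes "diagram t h" "i \<in> That t"
  shows "e \<le> h i \<Longrightarrow> (\<Sum>s\<in>{1..e}. (if odd s then 1 else - 1) * left_value t h s i) =
    (if odd e then left_value t h e i else 0)"
proof (induction e)
  case (Suc e)
  then show ?case
    using left_value_step[OF assms(1) _ _ assms(2), of e] by auto
qed simp

lemma right_value_0: "right_value t h 0 i = (if i \<in> T t then c i else 0)"
proof (cases "i \<in> T t")
  case True
  then show ?thesis using right_value_gap[OF gap.base] by simp
next
  case False
  then show ?thesis
    unfolding right_value_def by (auto intro!: label_value_none elim!: gap_0E)
qed

text \<open>
  In each column the left and the right labels cancel in pairs of consecutive rows, so only the label
  \<open>i\<close> at level \<open>0\<close> and the top label remain.
\<close>

lemma tableau_function_eq:
  assumes "diagram t h"
  shows "tableau_function t h =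
    - (\<Sum>i\<in>T t. c i * m i) + (\<Sum>i\<in>That t. (if i \<in> T t then c i else 0) * potential i)
    - label_sum t h c potential"
proof -
  define sg :: "nat \<Rightarrow> polynomial" where "sg s = (if odd s then 1 else - 1)" for s
  define g where "g s i = sg s * (right_value t h s i - left_value t h s i) * potential i" for s i
  have "(\<Sum>s\<in>{1..height t h}. row_function t h s) =
      (\<Sum>s\<in>{1..height t h}. \<Sum>i | i \<in> That t \<and> s \<le> h i. g s i)"
    unfolding row_function_eq sg_def[symmetric] g_def row_def
    by (simp only: sum_distrib_left mult.assoc)
  also have "\<dots> = (\<Sum>i\<in>That t. \<Sum>s | s \<in> {1..height t h} \<and> s \<le> h i. g s i)"
    by (rule sum.swap_restrict) auto
  also have "\<dots> = (\<Sum>i\<in>That t. ((if i \<in> T t then c i else 0) - label_value c (top_label t h i)) * potential i)"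
  proof (rule sum.cong[OF refl])
    fix i assume i: "i \<in> That t"
    have "{s. s \<in> {1..height t h} \<and> s \<le> h i} = {1..h i}"
      using height_ge[OF i, of h] by auto
    then have "(\<Sum>s | s \<in> {1..height t h} \<and> s \<le> h i. g s i) =
        ((\<Sum>s\<in>{1..h i}. sg s * right_value t h s i) - (\<Sum>s\<in>{1..h i}. sg s * left_value t h s i)) * potential i"
      unfolding g_def by (simp add: sum_subtractf sum_distrib_right right_diff_distrib left_diff_distrib)
    also have "\<dots> = (right_value t h 0 i -
        (if even (h i) then right_value t h (h i) i else left_value t h (h i) i)) * potential i"
      unfolding sg_def
      using alternating_sum_right_value[OF assms i order_refl] alternating_sum_left_value[OF assms i order_refl]
      by simp
    also have "(if even (h i) then right_value t h (h i) i else left_value t h (h i) i) =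
        label_value c (top_label t h i)"
      unfolding right_value_def left_value_def top_label_def by simp
    finally show "(\<Sum>s | s \<in> {1..height t h} \<and> s \<le> h i. g s i) =
        ((if i \<in> T t then c i else 0) - label_value c (top_label t h i)) * potential i"
      unfolding right_value_0 .
  qed
  also have "\<dots> = (\<Sum>i\<in>That t. (if i \<in> T t then c i else 0) * potential i) - label_sum t h c potential"
    unfolding label_sum_def by (simp only: left_diff_distrib sum_subtractf)
  finally show ?thesis
    unfolding tableau_function_def by simp
qed


subsection \<open>Duality\<close>

text \<open>
  Reflecting a diagram and adding a full row at the bottom exchanges left and right as well as even
  and odd.
\<close>

definition dual :: "nat \<Rightarrow> (nat \<Rightarrow> nat) \<Rightarrow> nat \<Rightarrow> nat" where
  "dual t h i = (if i \<in> That t then Suc (h (t + 2 - i)) else 0)"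

lemma mirror_in: "i \<in> That t \<Longrightarrow> t + 2 - i \<in> That t"
  by auto

lemma dual_mirror: "i \<in> That t \<Longrightarrow> dual t h (t + 2 - i) = Suc (h i)"
  unfolding dual_def by auto

lemma ball_mirror: "(\<forall>i \<in> That t. P i) \<longleftrightarrow> (\<forall>i \<in> That t. P (t + 2 - i))"
proof
  assume R: "\<forall>i \<in> That t. P (t + 2 - i)"
  show "\<forall>i \<in> That t. P i"
  proof
    fix i assume "i \<in> That t"
    moreover from this have "P (t + 2 - (t + 2 - i))"
      using R mirror_in by blast
    ultimately show "P i" by simp
  qed
qed (use mirror_in in blast)

lemma left_neighbour_dual:
  assumes "left_neighbour t h s p q"
  shows "left_neighbour t (dual t h) (Suc s) (t + 2 - q) (t + 2 - p)"
proof -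
  note pq = left_neighbourD[OF assms]
  have "dual t h l < Suc s" if "t + 2 - q < l" "l < t + 2 - p" for l
    using left_neighbour_between[OF assms, of "t + 2 - l"] that pq unfolding dual_def by auto
  then show ?thesis
    unfolding left_neighbour_iff dual_mirror[OF pq(1)] dual_mirror[OF pq(2)] using pq by auto
qed

lemma left_neighbour_of_dual:
  assumes "left_neighbour t (dual t h) (Suc s) p q"
  shows "left_neighbour t h s (t + 2 - q) (t + 2 - p)"
proof -
  note pq = left_neighbourD[OF assms]
  have "h l < s" if "t + 2 - q < l" "l < t + 2 - p" for l
    using left_neighbour_between[OF assms, of "t + 2 - l"] dual_mirror[of l t h] that pq by auto
  moreover have "s \<le> h (t + 2 - q)" "s \<le> h (t + 2 - p)"
    using pq unfolding dual_def by auto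
  ultimately show ?thesis
    unfolding left_neighbour_iff using pq by auto
qed

text \<open>All columns reach the added row, so nothing merges below it and the labels of level 0
  arrive unchanged at level 1. From there on the shifted parity exchanges the two rules, just as the
  reflection exchanges the two ends.\<close>

lemma gap_dual: "gap t h j p q a \<Longrightarrow> gap t (dual t h) (Suc j) (t + 2 - q) (t + 2 - p) (t + 1 - a)"
proof (induction rule: gap.induct)
  case (base p)
  have "gap t (dual t h) 0 (t + 1 - p) (Suc (t + 1 - p)) (t + 1 - p)"
    using base by (intro gap.base) auto
  moreover have "left_neighbour t h 0 p (Suc p)"
    using base by (auto simp: left_neighbour_iff)
  from left_neighbour_dual[OF this]
  have "left_neighbour t (dual t h) (Suc 0) (t + 1 - p) (t + 2 - p)"
    using base by simp
  ultimately show ?case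
    using gap.even[of t "dual t h" 0] by auto
next
  case (even j p q' a q)
  then show ?case
    using gap.odd[of t "dual t h" "Suc j"] left_neighbour_dual by (metis even_Suc)
next
  case (odd j p' q a p)
  then show ?case
    using gap.even[of t "dual t h" "Suc j"] left_neighbour_dual by (metis even_Suc)
qed

lemma gap_of_dual:
  assumes "gap t (dual t h) (Suc j) p q a"
  shows "gap t h j (t + 2 - q) (t + 2 - p) (t + 1 - a)"
proof -
  have pq: "left_neighbour t (dual t h) (Suc j) p q"
    using assms by (rule gap_left_neighbour)
  obtain b where b: "gap t h j (t + 2 - q) (t + 2 - p) b"
    using left_neighbour_of_dual[OF pq] gap_exists by blast
  have "t + 2 - (t + 2 - p) = p" "t + 2 - (t + 2 - q) = q"
    using left_neighbourD[OF pq] by auto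
  then have "a = t + 1 - b"
    using gap_dual[OF b] gap_unique[OF assms] by auto
  then have "b = t + 1 - a"
    using gap_label[OF b] by auto
  then show ?thesis using b by simp
qed

lemma top_label_dual:
  assumes "top_label t h i a"
  shows "top_label t (dual t h) (t + 2 - i) (t + 1 - a)"
proof -
  have "dual t h (t + 2 - i) = Suc (h i)"
    using top_label_in[OF assms] by (intro dual_mirror) auto
  then show ?thesis
    using assms gap_dual unfolding top_label_def by (metis even_Suc)
qed

lemma diagram_dual:
  assumes "diagram t h"
  shows "diagram t (dual t h)"
proof -
  note d = assms[unfolded diagram_iff]
  have mono: "t + 2 - p < t + 2 - i \<longleftrightarrow> i < p" if "i \<in> That t" "p \<in> That t" for i p
    using that by auto
  have A: "even (dual t h (t + 2 - i)) \<or> (\<forall>l \<in> That t. dual t h l \<le> dual t h (t + 2 - i))"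
    if i: "i \<in> That t" and
      *: "\<forall>p \<in> That t. p < t + 2 - i \<longrightarrow> dual t h p < dual t h (t + 2 - i)" for i
  proof -
    have "\<forall>p \<in> That t. i < p \<longrightarrow> h p < h i"
      using *[rule_format, OF mirror_in] i mono by (metis Suc_less_eq dual_mirror)
    then have "odd (h i) \<or> (\<forall>l \<in> That t. h l \<le> h i)"
      using d i by blast
    then show ?thesis
      using i dual_mirror ball_mirror[of t "\<lambda>l. dual t h l \<le> dual t h (t + 2 - i)"]
      by (metis Suc_le_mono even_Suc)
  qed
  have B: "odd (dual t h (t + 2 - i)) \<or> (\<forall>l \<in> That t. dual t h l \<le> dual t h (t + 2 - i))"
    if i: "i \<in> That t" and
      *: "\<forall>p \<in> That t. t + 2 - i < p \<longrightarrow> dual t h p < dual t h (t + 2 - i)" for i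
  proof -
    have "\<forall>p \<in> That t. p < i \<longrightarrow> h p < h i"
      using *[rule_format, OF mirror_in] i mono by (metis Suc_less_eq dual_mirror)
    then have "even (h i) \<or> (\<forall>l \<in> That t. h l \<le> h i)"
      using d i by blast
    then show ?thesis
      using i dual_mirror ball_mirror[of t "\<lambda>l. dual t h l \<le> dual t h (t + 2 - i)"]
      by (metis Suc_le_mono even_Suc)
  qed
  show ?thesis
    unfolding diagram_iff
  proof (intro conjI)
    show "\<forall>i. i \<notin> That t \<longrightarrow> dual t h i = 0"
      by (auto simp: dual_def)
  qed (rule ball_mirror[THEN iffD2], intro ballI impI, rule A B; assumption)+
qed

lemma strongly_extremal_dual: "strongly_extremal t (dual t h) = t + 2 - strongly_extremal t h"
proof -
  define e where "e = strongly_extremal t h"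
  have e: "e \<in> That t" "h e = height t h"
    "\<And>l. l \<in> That t \<Longrightarrow> (if odd (height t h) then l < e else e < l) \<Longrightarrow> h l < h e"
    using strongly_extremal_iff[of t h e] unfolding e_def by auto
  have "dual t h l \<le> Suc (height t h)" for l
    using height_ge[OF mirror_in, of l t h] unfolding dual_def by simp
  then have height: "height t (dual t h) = Suc (height t h)"
    using eq_height_iff[OF mirror_in[OF e(1)], of "dual t h"] dual_mirror[OF e(1), of h] e(2) by simp
  have "dual t h l < dual t h (t + 2 - e)"
    if "l \<in> That t" "if odd (Suc (height t h)) then l < t + 2 - e else t + 2 - e < l" for l
    using e(3)[of "t + 2 - l"] that e(1) dual_mirror[OF e(1), of h] unfolding dual_def[of t h l]
    by (auto split: if_splits)
  then have "strongly_extremal t (dual t h) = t + 2 - e"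
    unfolding strongly_extremal_iff height using e dual_mirror[OF e(1), of h] by auto
  then show ?thesis unfolding e_def .
qed

lemma label_value_top_label:
  assumes "top_label t h i a"
  shows "label_value C (top_label t h i) = C a"
  using assms by (intro label_value_eq) (auto dest: top_label_unique)

lemma label_value_strongly_extremal:
  "diagram t h \<Longrightarrow> label_value C (top_label t h (strongly_extremal t h)) = 0"
  using top_label_exists_iff[OF _ strongly_extremal_in] by (intro label_value_none) auto

lemma label_sum_dual:
  assumes "diagram t h"
  shows "label_sum t (dual t h) C R = label_sum t h (\<lambda>a. C (t + 1 - a)) (\<lambda>i. R (t + 2 - i))"
  unfolding label_sum_def
proof (rule sum.reindex_bij_witness[of _ "\<lambda>i. t + 2 - i" "\<lambda>i. t + 2 - i"])
  fix i assume "i \<in> That t"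
  then have i: "t + 2 - i \<in> That t" "t + 2 - (t + 2 - i) = i"
    by auto
  have "label_value (\<lambda>a. C (t + 1 - a)) (top_label t h (t + 2 - i)) =
      label_value C (top_label t (dual t h) i)"
  proof (cases "t + 2 - i = strongly_extremal t h")
    case True
    then show ?thesis
      using label_value_strongly_extremal[OF assms]
        label_value_strongly_extremal[OF diagram_dual[OF assms]] i
      unfolding strongly_extremal_dual by metis
  next
    case False
    then obtain a where "top_label t h (t + 2 - i) a"
      using top_label_exists_iff[OF assms i(1)] by auto
    then show ?thesis
      using top_label_dual label_value_top_label i by metis
  qed
  then show "label_value (\<lambda>a. C (t + 1 - a)) (top_label t h (t + 2 - i)) * R (t + 2 - (t + 2 - i)) =
      label_value C (top_label t (dual t h) i) * R i"
    using i by simp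
qed auto

section \<open>Completeness and compatibility of the dual\<close>

lemma complete_dual:
  assumes "complete t h"
  shows "complete t (dual t h)"
proof -
  have d: "diagram t h" and n: "\<And>p. \<not> adjoinable t h p"
    using assms unfolding complete_def by auto
  have False if adj: "adjoinable t (dual t h) p" for p
  proof -
    have p: "p \<in> That t"
      using adj unfolding adjoinable_def by auto
    then have dp: "dual t h p = Suc (h (t + 2 - p))"
      unfolding dual_def by auto
    have "adjoinable t h (t + 2 - p)"
    proof (cases "even (dual t h p)")
      case True
      then obtain q where q: "p < q" "dual t h p + 2 \<le> dual t h q"
        "\<And>l. p < l \<Longrightarrow> l < q \<Longrightarrow> dual t h l \<le> dual t h p"
        using adjoinable_even[OF diagram_dual[OF d] adj] by blast
      have "q \<in> That t"
        using q(2) unfolding dual_def by (auto split: if_splits)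
      moreover have "h l \<le> h (t + 2 - p)" if "t + 2 - q < l" "l < t + 2 - p" for l
        using q(3)[of "t + 2 - l"] dual_mirror[of l t h] that calculation p dp by auto
      ultimately show ?thesis
        using True q p dp unfolding adjoinable_iff[OF d]
        by (intro conjI disjI2 exI[of _ "t + 2 - q"]) (auto simp: dual_def)
    next
      case False
      then obtain q where q: "q < p" "dual t h p + 2 \<le> dual t h q"
        "\<And>l. q < l \<Longrightarrow> l < p \<Longrightarrow> dual t h l \<le> dual t h p"
        using adjoinable_odd[OF diagram_dual[OF d] adj] by blast
      have "q \<in> That t"
        using q(2) unfolding dual_def by (auto split: if_splits)
      moreover have "h l \<le> h (t + 2 - p)" if "t + 2 - p < l" "l < t + 2 - q" for l
        using q(3)[of "t + 2 - l"] dual_mirror[of l t h] that calculation p dp by auto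
      ultimately show ?thesis
        using False q p dp unfolding adjoinable_iff[OF d]
        by (intro conjI disjI1 exI[of _ "t + 2 - q"]) (auto simp: dual_def)
    qed
    then show False using n by blast
  qed
  then show ?thesis
    unfolding complete_def using diagram_dual[OF d] by blast
qed

text \<open>On \<open>T t\<close> the truncated subtraction is an involution; the restriction is
  what puts the double dual inside \<open>r\<close>.\<close>

definition dual_order :: "nat \<Rightarrow> (nat \<times> nat) set \<Rightarrow> (nat \<times> nat) set" where
  "dual_order t r = {(a, b) \<in> T t \<times> T t. (t + 1 - a, t + 1 - b) \<in> r}"

lemma strict_linear_order_dual:
  assumes "strict_linear_order_on (T t) r"
  shows "strict_linear_order_on (T t) (dual_order t r)"
proof -
  have "trans r" "irrefl r" "total_on (T t) r"
    using assms unfolding strict_linear_order_on_def by auto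
  note r = this[unfolded trans_def irrefl_def total_on_def]
  have "trans (dual_order t r)" "irrefl (dual_order t r)"
    using r(1,2) unfolding trans_def irrefl_def dual_order_def by blast+
  moreover have "total_on (T t) (dual_order t r)"
    unfolding total_on_def
  proof (intro ballI impI)
    fix a b assume ab: "a \<in> T t" "b \<in> T t" "a \<noteq> b"
    then have "t + 1 - a \<in> T t" "t + 1 - b \<in> T t" "t + 1 - a \<noteq> t + 1 - b"
      by auto
    then show "(a, b) \<in> dual_order t r \<or> (b, a) \<in> dual_order t r"
      using r(3) ab unfolding dual_order_def by blast
  qed
  ultimately show ?thesis
    unfolding strict_linear_order_on_def by blast
qed

lemma compatible_dual:
  assumes "compatible t r h"
  shows "compatible t (dual_order t r) (dual t h)"
  unfolding compatible_iff
proof (intro allI impI, elim conjE)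
  fix j p q a l l' b
  assume g: "gap t (dual t h) (Suc j) p q a" "gap t (dual t h) j l l' b"
    and le: "p \<le> l" "l' \<le> q" and ne: "\<not> (if even j then l = p else l' = q)"
  have pq: "left_neighbour t (dual t h) (Suc j) p q" and ll: "left_neighbour t (dual t h) j l l'"
    using g gap_left_neighbour by auto
  show "(a, b) \<in> dual_order t r"
  proof (cases j)
    \<comment> \<open>The added bottom row is full, so no gaps merge between levels 0 and 1.\<close>
    case 0
    then have "l = p"
      using left_neighbour_between[OF pq, of l] left_neighbourD[OF ll] le
      unfolding dual_def by fastforce
    then show ?thesis using ne 0 by simp
  next
    case (Suc i)
    have "(t + 1 - a, t + 1 - b) \<in> r"
    proof (rule assms[unfolded compatible_iff, rule_format], intro conjI)
      show "gap t h (Suc i) (t + 2 - q) (t + 2 - p) (t + 1 - a)"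
        "gap t h i (t + 2 - l') (t + 2 - l) (t + 1 - b)"
        using g gap_of_dual unfolding Suc by auto
      show "t + 2 - q \<le> t + 2 - l'" "t + 2 - l \<le> t + 2 - p"
        using le by auto
      show "\<not> (if even i then t + 2 - l' = t + 2 - q else t + 2 - l = t + 2 - p)"
        using ne left_neighbourD[OF pq] left_neighbourD[OF ll] unfolding Suc by (auto split: if_splits)
    qed
    then show ?thesis
      using gap_label[OF g(1)] gap_label[OF g(2)] unfolding dual_order_def by auto
  qed
qed


subsection \<open>Invariance under the moves\<close>

lemma top_label_of_dual:
  assumes "top_label t (dual t h) i a"
  shows "top_label t h (t + 2 - i) (t + 1 - a)"
proof -
  have "dual t h i = Suc (h (t + 2 - i))"
    using top_label_in[OF assms] unfolding dual_def by simp
  then show ?thesis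
    using assms gap_of_dual unfolding top_label_def by (metis even_Suc)
qed

lemma strongly_extremal_cong:
  assumes "diagram t h" "diagram t h'" "\<And>i a. top_label t h i a \<Longrightarrow> top_label t h' i a"
  shows "strongly_extremal t h' = strongly_extremal t h"
  using top_label_exists_iff[OF assms(1) strongly_extremal_in, of h']
    top_label_exists_iff[OF assms(2) strongly_extremal_in, of h'] assms(3) by blast

text \<open>An inclusion is enough: both relations are functional and defined on all columns but
  one, so their domains coincide.\<close>

lemma top_label_eqI:
  assumes "diagram t h" "diagram t h'" "\<And>i a. top_label t h i a \<Longrightarrow> top_label t h' i a"
  shows "top_label t h = top_label t h'"
proof (intro ext iffI)
  fix i a assume a: "top_label t h' i a"
  then have "i \<noteq> strongly_extremal t h" "i \<in> That t"
    using top_label_exists_iff[OF assms(2)] top_label_in strongly_extremal_cong[OF assms] by metis+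
  then obtain b where "top_label t h i b"
    using top_label_exists_iff[OF assms(1)] by blast
  then show "top_label t h i a"
    using assms(3) a top_label_unique by metis
qed (rule assms(3))

section \<open>Top labels under the individual moves\<close>

lemma left_neighbour_cong:
  "(\<And>l. s \<le> h l \<longleftrightarrow> s' \<le> h' l) \<Longrightarrow> left_neighbour t h s p q \<longleftrightarrow> left_neighbour t h' s' p q"
  unfolding left_neighbour_iff by (metis not_le)

lemma gap_cong:
  assumes "gap t h j p q a" "\<And>s l. s \<le> j \<Longrightarrow> s \<le> h l \<longleftrightarrow> s \<le> h' l"
  shows "gap t h' j p q a"
  using assms
proof (induction rule: gap.induct)
  case (base p)
  then show ?case by (intro gap.base)
next
  case (even j p q' a q)
  then show ?case
    using left_neighbour_cong[of "Suc j" h "Suc j" h' t p q] by (intro gap.even[of _ _ _ _ q']) auto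
next
  case (odd j p' q a p)
  then show ?case
    using left_neighbour_cong[of "Suc j" h "Suc j" h' t p q] by (intro gap.odd[of _ _ _ p']) auto
qed

text \<open>The raised column cuts at most one gap on each of the levels \<open>h p + 1\<close> and
  \<open>h p + 2\<close>. Labels enter and leave these two rows through left ends, because
  \<open>h p\<close> is even, so the left part keeps the old label and all higher gaps are
  unaffected.\<close>

lemma gap_left_domino:
  assumes "gap t h j x y a" "even (h p)" "p \<in> That t" "q \<in> That t" "p < q" "h p + 2 \<le> h q"
    and h': "h' = h(p := h p + 2)"
    and between: "\<And>l. p < l \<Longrightarrow> l < q \<Longrightarrow> h l \<le> h p"
  shows "gap t h' j x (if j \<in> {h p + 1, h p + 2} \<and> x < p \<and> p < y then p else y) a"
proof -
  have cong: "left_neighbour t h' s x y \<longleftrightarrow> left_neighbour t h s x y"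
    if "s \<notin> {h p + 1, h p + 2}" for s x y
    by (rule left_neighbour_cong) (use that in \<open>auto simp: h'\<close>)
  show ?thesis
    using assms(1)
  proof (induction rule: gap.induct)
    case (base x)
    then show ?case using gap.base[of x] by auto
  next
    case (even j x y' a y)
    have xy: "left_neighbour t h (Suc j) x y" by fact
    show ?case
    proof (cases "Suc j \<in> {h p + 1, h p + 2}")
      case True
      then have j: "j = h p" using even.hyps assms(2) by auto
      then have "gap t h' j x y' a"
        using even.IH by simp
      moreover have "left_neighbour t h' (Suc j) x (if x < p \<and> p < y then p else y)"
        using xy j assms(3) unfolding left_neighbour_iff h' by auto
      ultimately show ?thesis
        using gap.even[OF _ \<open>even j\<close>] True by simp
    next
      case False
      then have "left_neighbour t h' (Suc j) x y"
        using xy cong by simp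
      then show ?thesis
        using gap.even[OF even.IH \<open>even j\<close>] False by simp
    qed
  next
    case (odd j z y a x)
    have xy: "left_neighbour t h (Suc j) x y" by fact
    have zy: "left_neighbour t h j z y" using odd.hyps gap_left_neighbour by blast
    show ?case
    proof (cases "Suc j \<in> {h p + 1, h p + 2}")
      case True
      then have j: "j = Suc (h p)" using odd.hyps assms(2) by auto
      have "x \<le> z"
        using left_neighbour_between[OF zy, of x] left_neighbourD[OF xy] by (meson Suc_leD not_le)
      \<comment> \<open>Between the two new rows labels pass through right ends. The cut gap ends in
        \<open>q\<close> on both levels, so \<open>p\<close> replaces \<open>q\<close> on both and
        the label still passes up.\<close>
      have "z < p" if "x < p" "p < y"
      proof -
        have "\<not> q < y"
          using left_neighbour_between[OF xy, of q] that assms(5,6) j by linarith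
        moreover have "\<not> y < q"
          using left_neighbourD(5)[OF xy] between[of y] that j by linarith
        ultimately have "y = q"
          by simp
        then have "\<not> p < z"
          using left_neighbourD(3,4)[OF zy] between[of z] j by linarith
        moreover have "z \<noteq> p"
          using left_neighbourD(4)[OF zy] j by auto
        ultimately show "z < p"
          by simp
      qed
      then have "z < p \<and> p < y \<longleftrightarrow> x < p \<and> p < y"
        using \<open>x \<le> z\<close> by auto
      then have "gap t h' j z (if x < p \<and> p < y then p else y) a"
        using odd.IH j by simp
      moreover have "left_neighbour t h' (Suc j) x (if x < p \<and> p < y then p else y)"
        using xy j assms(3) unfolding left_neighbour_iff h' by auto
      ultimately show ?thesis
        using gap.odd[OF _ \<open>odd j\<close>] True by simp
    next
      case False
      then have "left_neighbour t h' (Suc j) x y"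
        using xy cong by simp
      moreover have "j \<noteq> h p + 2" "j \<noteq> h p + 1"
        using odd.hyps assms(2) False by auto
      ultimately show ?thesis
        using gap.odd[OF _ \<open>odd j\<close>] odd.IH False by simp
    qed
  qed
qed

text \<open>The label behind column \<open>p\<close> at its old height passes to the new gap from
  \<open>p\<close> to \<open>q\<close>, first through the left end \<open>p\<close>, then through
  the right end \<open>q\<close>, and is again the top label of \<open>p\<close>.\<close>

lemma top_label_left_domino:
  assumes "top_label t h i a" "even (h p)" "p \<in> That t" "q \<in> That t" "p < q" "h p + 2 \<le> h q"
    and between: "\<And>l. p < l \<Longrightarrow> l < q \<Longrightarrow> h l \<le> h p"
  shows "top_label t (h(p := h p + 2)) i a"
proof -
  let ?h = "h(p := h p + 2)"
  note dom = gap_left_domino[OF _ assms(2-6) refl between]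
  show ?thesis
  proof (cases "i = p")
    case True
    then obtain y where "gap t h (h p) p y a"
      using assms(1,2) unfolding top_label_def by auto
    then have "gap t ?h (h p) p y a"
      using dom[of "h p" p y a] by simp
    moreover have *: "left_neighbour t ?h (Suc (h p)) p q" "left_neighbour t ?h (Suc (Suc (h p))) p q"
      using assms unfolding left_neighbour_iff by (auto simp: less_Suc_eq_le le_SucI)
    ultimately have "gap t ?h (Suc (h p)) p q a"
      using gap.even assms(2) by metis
    from gap.odd[OF this _ *(2)] show ?thesis
      using True assms(2) unfolding top_label_def by auto
  next
    case False
    show ?thesis
    proof (cases "even (h i)")
      case True
      then obtain y where y: "gap t h (h i) i y a"
        using assms(1) unfolding top_label_def by auto
      then show ?thesis
        using dom[OF y] False True unfolding top_label_def by auto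
    next
      case odd: False
      then obtain x where x: "gap t h (h i) x i a"
        using assms(1) unfolding top_label_def by auto
      \<comment> \<open>A cut gap ends in \<open>q\<close>, which is too high for this gap to be its
        top gap.\<close>
      have "\<not> (h i = h p + 1 \<and> x < p \<and> p < i)"
      proof
        assume i: "h i = h p + 1 \<and> x < p \<and> p < i"
        then have "q < i"
          using between[of i] assms(6) by (cases i q rule: linorder_cases) auto
        then show False
          using left_neighbour_between[OF gap_left_neighbour[OF x], of q] i assms(5,6) by simp
      qed
      moreover have "h i \<noteq> h p + 2"
        using odd assms(2) by auto
      ultimately have "gap t ?h (h i) x i a"
        using dom[OF x] by auto
      then show ?thesis
        using False odd unfolding top_label_def by auto
    qed
  qed
qed

lemma top_label_right_domino:
  assumes "top_label t h i a" "odd (h p)" "p \<in> That t" "q \<in> That t" "q < p" "h p + 2 \<le> h q"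
    and between: "\<And>l. q < l \<Longrightarrow> l < p \<Longrightarrow> h l \<le> h p"
  shows "top_label t (h(p := h p + 2)) i a"
proof -
  have eq: "dual t (h(p := h p + 2)) = (dual t h)(t + 2 - p := dual t h (t + 2 - p) + 2)"
    using assms(3) by (auto simp: dual_def fun_eq_iff)
  have l: "dual t h l \<le> dual t h (t + 2 - p)" if "t + 2 - p < l" "l < t + 2 - q" for l
    unfolding dual_mirror[OF assms(3)] using between[of "t + 2 - l"] that assms(3,4)
    unfolding dual_def by auto
  have "top_label t (dual t (h(p := h p + 2))) (t + 2 - i) (t + 1 - a)"
    unfolding eq
  proof (rule top_label_left_domino[OF top_label_dual[OF assms(1)] _ mirror_in[OF assms(3)]
        mirror_in[OF assms(4)] _ _ l])
    show "even (dual t h (t + 2 - p))" "dual t h (t + 2 - p) + 2 \<le> dual t h (t + 2 - q)"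
      unfolding dual_mirror[OF assms(3)] dual_mirror[OF assms(4)] using assms by auto
  qed (use assms in auto)
  from top_label_of_dual[OF this] show ?thesis
    using top_label_in[OF assms(1)] by simp
qed

text \<open>The strongly extremal column has maximal height, so no row up to the height of another
  column changes.\<close>

lemma top_label_half_domino:
  assumes "top_label t h i a" "i \<noteq> strongly_extremal t h"
  shows "top_label t (h(strongly_extremal t h := h (strongly_extremal t h) + 1)) i a"
proof -
  define e where "e = strongly_extremal t h"
  have "i \<in> That t" using top_label_in[OF assms(1)] by simp
  then have "h i \<le> h e"
    using height_ge strongly_extremal_iff unfolding e_def by metis
  define h' where "h' = h(e := h e + 1)"
  have "gap t h' (h i) x y a" if "gap t h (h i) x y a" for x y
    using that by (rule gap_cong) (use \<open>h i \<le> h e\<close> in \<open>auto simp: h'_def\<close>)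
  moreover have "h' i = h i"
    using assms(2) unfolding h'_def e_def by simp
  ultimately show ?thesis
    using assms(1) unfolding e_def[symmetric] h'_def[symmetric] top_label_def by metis
qed

text \<open>No column ends at level \<open>i + 1\<close>, so the two rows have the same gaps with
  the same labels. The inheritance rules before and after them depend on the same parity and compose
  to the single step that remains.\<close>

lemma top_label_row_cancellation:
  assumes "top_label t h x a" and h: "\<And>l. h l \<noteq> Suc i"
  shows "top_label t (\<lambda>p. if i + 2 \<le> h p then h p - 2 else h p) x a"
proof -
  define h' where "h' = (\<lambda>p. if i + 2 \<le> h p then h p - 2 else h p)"
  have low: "gap t h' j x y a" if "gap t h j x y a" "j \<le> i" for j x y a
    using that(1) by (rule gap_cong) (use that(2) in \<open>auto simp: h'_def\<close>)
  have row: "Suc (Suc i) \<le> h l \<longleftrightarrow> Suc i \<le> h l" for l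
    using h[of l] by auto
  have row': "i + 3 + k \<le> h l \<longleftrightarrow> Suc i + k \<le> h' l" for k l
    using h[of l] unfolding h'_def by auto
  \<comment> \<open>A label of level \<open>i + 2\<close> comes from level \<open>i\<close> through
    the end prescribed by the parity of \<open>i\<close>, which is also the rule from level
    \<open>i + 2\<close> to \<open>i + 3\<close>.\<close>
  have skip: "if even i then \<exists>z. gap t h i x z a else \<exists>z. gap t h i z y a"
    if g: "gap t h (Suc (Suc i)) x y a" for x y a
  proof -
    have *: "left_neighbour t h (Suc (Suc i)) x y" "left_neighbour t h (Suc i) x y"
      using gap_left_neighbour[OF g] left_neighbour_cong[of "Suc (Suc i)" h "Suc i" h t x y] row by auto
    obtain b where b: "gap t h (Suc i) x y b"
      using gap_exists[OF *(2)] by blast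
    then have "gap t h (Suc (Suc i)) x y b"
      using gap.even gap.odd *(1) by metis
    then have "gap t h (Suc i) x y a"
      using b gap_unique[OF g] by simp
    then show ?thesis by (auto elim!: gap_SucE)
  qed
  have high: "gap t h' (Suc i + k) x y a" if "gap t h (i + 3 + k) x y a" for k x y a
    using that
  proof (induction k arbitrary: x y)
    case 0
    then have g: "gap t h (Suc (Suc (Suc i))) x y a"
      by (simp add: numeral_3_eq_3)
    from 0 have xy: "left_neighbour t h' (Suc i) x y"
      using gap_left_neighbour[OF 0] left_neighbour_cong[of "i + 3" h "Suc i" h' t x y] row'[of 0]
      by simp
    show ?case
    proof (cases "even i")
      case True
      then obtain z where "gap t h (Suc (Suc i)) x z a"
        using gap_SucE[OF g] by (metis even_Suc)
      then obtain z' where "gap t h i x z' a"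
        using skip True by metis
      from gap.even[OF low[OF this order_refl] True xy] show ?thesis
        by simp
    next
      case False
      then obtain z where "gap t h (Suc (Suc i)) z y a"
        using gap_SucE[OF g] by (metis even_Suc)
      then obtain z' where "gap t h i z' y a"
        using skip False by metis
      from gap.odd[OF low[OF this order_refl] False xy] show ?thesis
        by simp
    qed
  next
    case (Suc k)
    then have xy: "left_neighbour t h' (Suc (Suc i + k)) x y"
      using gap_left_neighbour[OF Suc.prems]
        left_neighbour_cong[of "Suc (i + 3 + k)" h "Suc (Suc i + k)" h' t x y] row'[of "Suc k"]
      by simp
    have "gap t h (Suc (i + 3 + k)) x y a"
      using Suc.prems by simp
    then show ?case
    proof (cases rule: gap.cases)
      case (even q')
      then show ?thesis
        using gap.even[OF Suc.IH _ xy] by auto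
    next
      case (odd p')
      then show ?thesis
        using gap.odd[OF Suc.IH _ xy] by auto
    qed
  qed
  have "top_label t h' x a"
  proof (cases "h x \<le> i")
    case True
    then have "h' x = h x" unfolding h'_def by simp
    then show ?thesis
      using assms(1) low[OF _ True] unfolding top_label_def by metis
  next
    case False
    then have "h x = Suc (Suc i) \<or> h x = i + 3 + (h x - (i + 3))"
      using h[of x] by linarith
    then consider "h x = Suc (Suc i)" | k where "h x = i + 3 + k"
      by blast
    then show ?thesis
    proof cases
      case 1
      then have "h' x = i" unfolding h'_def by simp
      moreover have "if even i then \<exists>z. gap t h i x z a else \<exists>z. gap t h i z x a"
        using assms(1) skip[of x _ a] skip[of _ x a] unfolding top_label_def 1
        by (cases "even i") auto
      ultimately show ?thesis
        using low[OF _ order_refl] unfolding top_label_def by metis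
    next
      case (2 k)
      then have h': "h' x = Suc i + k" unfolding h'_def by simp
      have parity: "even (i + 3 + k) \<longleftrightarrow> even (Suc i + k)" by presburger
      show ?thesis
        using assms(1) high[of k x _ a] high[of k _ x a] unfolding top_label_def 2 h' parity
        by (cases "even (Suc i + k)") (auto simp del: even_Suc even_add)
    qed
  qed
  then show ?thesis unfolding h'_def .
qed

lemma top_label_move:
  assumes "move t h h'"
  shows "top_label t h = top_label t h'"
proof (rule top_label_eqI)
  show d: "diagram t h" "diagram t h'"
    using assms unfolding move_def by auto
  have z: "q \<in> That t" if "Suc n \<le> h q" for q n
    using d(1) that unfolding diagram_def by (metis Suc_n_not_le_n le0 le_trans)
  fix i a assume a: "top_label t h i a"
  consider "domino_move t h h'" | "half_domino_move t h h'" | "row_cancellation t h h'"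
    using assms unfolding move_def by blast
  then show "top_label t h' i a"
  proof cases
    case 1
    then obtain p where p: "adjoinable t h p" "h' = h(p := h p + 2)"
      unfolding domino_move_def by blast
    then have "p \<in> That t"
      unfolding adjoinable_def by blast
    show ?thesis
    proof (cases "even (h p)")
      case True
      then obtain q where "q > p" "h p + 2 \<le> h q" "\<And>l. p < l \<Longrightarrow> l < q \<Longrightarrow> h l \<le> h p"
        using adjoinable_even[OF d(1) p(1)] by blast
      then show ?thesis
        using top_label_left_domino[OF a True \<open>p \<in> That t\<close>, of q] z[of "h p + 1" q] p(2) by simp
    next
      case False
      then obtain q where "q < p" "h p + 2 \<le> h q" "\<And>l. q < l \<Longrightarrow> l < p \<Longrightarrow> h l \<le> h p"
        using adjoinable_odd[OF d(1) p(1)] by blast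
      then show ?thesis
        using top_label_right_domino[OF a False \<open>p \<in> That t\<close>, of q] z[of "h p + 1" q] p(2) by simp
    qed
  next
    case 2
    moreover have "i \<noteq> strongly_extremal t h"
      using top_label_exists_iff[OF d(1)] a top_label_in[OF a] by blast
    ultimately show ?thesis
      using top_label_half_domino[OF a] unfolding half_domino_move_def by simp
  next
    case 3
    then obtain k where k: "card (row t h (k + 1)) = card (row t h (k + 2))"
      "h' = (\<lambda>p. if k + 2 \<le> h p then h p - 2 else h p)"
      unfolding row_cancellation_def by blast
    have "row t h (k + 2) = row t h (k + 1)"
      by (rule card_subset_eq) (use k(1) in \<open>auto simp: row_def\<close>)
    then have "l \<in> That t \<Longrightarrow> k + 1 \<le> h l \<Longrightarrow> k + 2 \<le> h l" for l
      unfolding row_def by blast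
    then have "h l \<noteq> Suc k" for l
      using z[of k l] by force
    then show ?thesis
      using top_label_row_cancellation[OF a] k(2) by simp
  qed
qed

section \<open>Equivalence classes and their representatives\<close>

lemma top_label_diagram_equiv: "(h, h') \<in> diagram_equiv t \<Longrightarrow> top_label t h = top_label t h'"
proof -
  have "equivclp (move t) h h' \<Longrightarrow> top_label t h = top_label t h'"
    by (induction rule: equivclp_induct) (auto dest: top_label_move)
  then show "(h, h') \<in> diagram_equiv t \<Longrightarrow> top_label t h = top_label t h'"
    unfolding diagram_equiv_def by blast
qed

text \<open>The function and the strongly extremal column are determined by the top labels, which
  all members share, so \<open>the_elem\<close> is applied to singletons and any member may
  represent the class.\<close>

lemma H_element:
  assumes "F \<in> H t" "h \<in> F"
  shows "diagram t h" "class_function t F = tableau_function t h"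
    "F \<in> H_at t j \<longleftrightarrow> strongly_extremal t h = j"
proof -
  obtain h0 where F: "F = diagram_equiv t `` {h0}"
    using assms(1) unfolding H_def by (auto elim: quotientE)
  have d: "diagram t g" if "g \<in> F" for g
    using that unfolding F diagram_equiv_def by auto
  have eq: "top_label t g = top_label t h" if "g \<in> F" for g
    using that assms(2) top_label_diagram_equiv[of h0] unfolding F by (metis Image_singleton_iff)
  show "diagram t h" using d assms(2) .
  have "tableau_function t g = tableau_function t h" if "g \<in> F" for g
    unfolding tableau_function_eq[OF d[OF that]] tableau_function_eq[OF d[OF assms(2)]]
      label_sum_def eq[OF that] ..
  then show "class_function t F = tableau_function t h"
    unfolding class_function_def using assms(2) by (metis empty_iff the_elem_image_unique)
  have "strongly_extremal t g = strongly_extremal t h" if "g \<in> F" for g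
    using strongly_extremal_cong[OF d[OF assms(2)] d[OF that]] eq[OF that] by metis
  then have "the_elem (strongly_extremal t ` F) = strongly_extremal t h"
    using assms(2) by (metis empty_iff the_elem_image_unique)
  then show "F \<in> H_at t j \<longleftrightarrow> strongly_extremal t h = j"
    unfolding H_at_def using assms(1) by simp
qed

lemma H_exists: "diagram t h \<Longrightarrow> \<exists>F \<in> H t. h \<in> F"
  unfolding H_def
  by (intro bexI[of _ "diagram_equiv t `` {h}"] quotientI) (auto simp: diagram_equiv_def)


subsection \<open>Inserting and deleting a column\<close>

lemma gap_consecutive:
  assumes "s \<in> T t"
  shows "j \<le> h s \<Longrightarrow> j \<le> h (Suc s) \<Longrightarrow> gap t h j s (Suc s) s"
proof (induction j)
  case 0
  then show ?case using assms by (intro gap.base)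
next
  case (Suc j)
  then have "left_neighbour t h (Suc j) s (Suc s)"
    using assms unfolding left_neighbour_iff by auto
  then show ?case
    using Suc gap.even gap.odd by (metis Suc_leD)
qed

text \<open>If the gap labelled \<open>s\<close> ever widened, it would absorb another gap, and
  compatibility would place \<open>s\<close> below the label of that gap.\<close>

lemma gap_greatest_label:
  assumes "compatible t r h" "\<And>b. b \<in> T t \<Longrightarrow> (s, b) \<notin> r"
  shows "gap t h j p q s \<Longrightarrow> p = s \<and> q = Suc s"
proof (induction j arbitrary: p q)
  case 0
  then show ?case by (auto elim: gap_0E)
next
  case (Suc j)
  note pq = left_neighbourD[OF gap_left_neighbour[OF Suc.prems]]
  note min = assms(1)[unfolded compatible_iff, rule_format, of j p q s, OF conjI[OF Suc.prems]]
  show ?case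
  proof (cases "even j")
    case True
    then obtain q' where "gap t h j p q' s"
      using Suc.prems by (auto elim: gap_SucE)
    from Suc.IH[OF this] have s: "p = s" "gap t h j s (Suc s) s"
      using \<open>gap t h j p q' s\<close> by auto
    have "q = Suc s"
    proof (rule ccontr)
      assume "q \<noteq> Suc s"
      then have "Suc s < q" using pq s by simp
      then obtain l' where l': "l' \<le> q" "left_neighbour t h j (Suc s) l'"
        using left_neighbour_next[of "Suc s" t q j h] left_neighbourD[OF gap_left_neighbour[OF s(2)]] pq
        by (metis Suc_leD)
      then obtain b where b: "gap t h j (Suc s) l' b"
        using gap_exists by blast
      then have "(s, b) \<in> r"
        using min[of "Suc s" l' b] True l' s by simp
      then show False using assms(2) gap_label[OF b] by blast
    qed
    then show ?thesis using s by simp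
  next
    case False
    then obtain p' where "gap t h j p' q s"
      using Suc.prems by (auto elim: gap_SucE)
    from Suc.IH[OF this] have s: "q = Suc s" "gap t h j s (Suc s) s"
      using \<open>gap t h j p' q s\<close> by auto
    have "p = s"
    proof (rule ccontr)
      assume "p \<noteq> s"
      then have "p < s" using pq s by simp
      then obtain l where l: "p \<le> l" "left_neighbour t h j l s"
        using left_neighbour_previous[of p t s j h] left_neighbourD[OF gap_left_neighbour[OF s(2)]] pq
        by (metis Suc_leD)
      then obtain b where b: "gap t h j l s b"
        using gap_exists by blast
      then have "(s, b) \<in> r"
        using min[of l s b] False l s by simp
      then show False using assms(2) gap_label[OF b] by blast
    qed
    then show ?thesis using s by simp
  qed
qed

text \<open>Otherwise the lower of the two columns ends at the parity at which the gap keeps its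
  label through the other column. The boundary condition provides a further column, so a wider gap
  labelled \<open>s\<close> would arise.\<close>

lemma greatest_label_columns:
  assumes "diagram t h" "compatible t r h" "\<And>b. b \<in> T t \<Longrightarrow> (s, b) \<notin> r" "s \<in> T t"
  shows "even (h s) \<and> h s \<le> h (Suc s) \<or> odd (h (Suc s)) \<and> h (Suc s) \<le> h s"
proof (rule ccontr)
  assume neg: "\<not> ?thesis"
  have s: "s \<in> That t" "Suc s \<in> That t"
    using assms(4) by auto
  show False
  proof (cases "h (Suc s) < h s")
    case True
    then have ev: "even (h (Suc s))" using neg by auto
    obtain r' where r': "r' \<in> That t" "s < r'" "Suc (h (Suc s)) \<le> h r'"
      using right_column_above[OF assms(1) ev s(1) _ s(2)] True by auto
    then obtain q where q: "left_neighbour t h (Suc (h (Suc s))) s q"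
      using left_neighbour_next[of s t r' "Suc (h (Suc s))" h] s(1) r' True by auto
    have "gap t h (h (Suc s)) s (Suc s) s"
      using gap_consecutive[OF assms(4)] True by simp
    from gap_greatest_label[OF assms(2,3) gap.even[OF this ev q]]
    show False using left_neighbourD[OF q] by simp
  next
    case False
    then have od: "odd (h s)" "h s < h (Suc s)"
      using neg by (auto simp: not_less le_less)
    obtain r' where r': "r' \<in> That t" "r' < Suc s" "Suc (h s) \<le> h r'"
      using left_column_above[OF assms(1) od(1) s(2) _ s(1)] od(2) by auto
    then obtain p where p: "left_neighbour t h (Suc (h s)) p (Suc s)"
      using left_neighbour_previous[of r' t "Suc s" "Suc (h s)" h] s(2) r' od(2) by auto
    have "gap t h (h s) s (Suc s) s"
      using gap_consecutive[OF assms(4)] od(2) by simp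
    from gap_greatest_label[OF assms(2,3) gap.odd[OF this od(1) p]]
    show False using left_neighbourD[OF p] by simp
  qed
qed

text \<open>The order embedding that omits \<open>s\<close>. It renames columns and labels alike,
  since the label \<open>s\<close> disappears together with the column.\<close>

definition skip :: "nat \<Rightarrow> nat \<Rightarrow> nat" where
  "skip s i = (if i < s then i else Suc i)"

lemma skip_less [simp]: "skip s i < skip s j \<longleftrightarrow> i < j"
  and skip_le [simp]: "skip s i \<le> skip s j \<longleftrightarrow> i \<le> j"
  and skip_eq [simp]: "skip s i = skip s j \<longleftrightarrow> i = j"
  and skip_neq [simp]: "skip s i \<noteq> s" "s \<noteq> skip s i"
  and skip_less_self [simp]: "skip s i < s \<longleftrightarrow> i < s"
  and self_less_skip [simp]: "s < skip s i \<longleftrightarrow> s \<le> i"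
  unfolding skip_def by auto

lemma skip_cases: obtains "l = s" | i where "l = skip s i"
proof (cases "l = s")
  case False
  then have "l = skip s (if l < s then l else l - 1)"
    unfolding skip_def by auto
  then show ?thesis using that by blast
qed

definition delete_order :: "nat \<Rightarrow> (nat \<times> nat) set \<Rightarrow> (nat \<times> nat) set" where
  "delete_order s r = {(a, b). (skip s a, skip s b) \<in> r}"

text \<open>
  Column \<open>s\<close> of \<open>h\<close> is inserted into \<open>g\<close> to the left of the column \<open>g s\<close>. Up to level \<open>h s\<close> the gaps of
  \<open>g\<close> that end at that column now end at the new one, and the new gap behind it is labelled \<open>s\<close>.
\<close>

locale column_insertion =
  fixes t s :: nat and h :: "nat \<Rightarrow> nat"
  assumes s: "s \<in> T (Suc t)"
    and zero: "\<And>i. i \<notin> That (Suc t) \<Longrightarrow> h i = 0"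
    and even_s: "even (h s)"
    and le: "h s \<le> h (Suc s)"
begin

definition g :: "nat \<Rightarrow> nat" where
  "g i = h (skip s i)"

definition target :: "nat \<Rightarrow> nat \<Rightarrow> nat" where
  "target j q = (if q = s \<and> j \<le> h s then s else skip s q)"

lemma g_s: "g s = h (Suc s)"
  unfolding g_def skip_def by simp

lemma s_in: "s \<in> That (Suc t)" "s \<in> That t"
  using s by auto

lemma skip_in [simp]: "skip s i \<in> That (Suc t) \<longleftrightarrow> i \<in> That t"
  and skip_in_T [simp]: "skip s i \<in> T (Suc t) \<longleftrightarrow> i \<in> T t"
  using s unfolding skip_def by auto

lemma That_Suc: "That (Suc t) = insert s (skip s ` That t)"
proof -
  have "l \<in> insert s (skip s ` That t)" if "l \<in> That (Suc t)" for l
    using that skip_in by (cases l rule: skip_cases[of _ s]) (auto simp del: atLeastAtMost_iff)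
  then show ?thesis
    using s_in skip_in by blast
qed

lemma ball_That_Suc: "(\<forall>i \<in> That (Suc t). P i) \<longleftrightarrow> P s \<and> (\<forall>i \<in> That t. P (skip s i))"
  unfolding That_Suc by blast

text \<open>Column \<open>s\<close> meets the left condition by its even height and is never right
  extremal, because column \<open>Suc s\<close> is at least as high. It must only be checked that it
  does not relieve another column of its condition.\<close>

lemma diagram_iff_delete: "diagram (Suc t) h \<longleftrightarrow> diagram t g"
proof -
  have z: "(\<forall>i. i \<notin> That (Suc t) \<longrightarrow> h i = 0)" "(\<forall>i. i \<notin> That t \<longrightarrow> g i = 0)"
    using zero skip_in unfolding g_def by blast+
  have max: "(\<forall>l \<in> That (Suc t). h l \<le> h (skip s i)) \<longleftrightarrow> (\<forall>l \<in> That t. g l \<le> g i)" for i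
    unfolding ball_That_Suc using le s_in(2) unfolding g_s[symmetric] g_def[symmetric]
    by (meson le_trans)
  have left: "(\<forall>p \<in> That (Suc t). p < skip s i \<longrightarrow> h p < h (skip s i)) \<longleftrightarrow>
      (s \<le> i \<longrightarrow> h s < g i) \<and> (\<forall>p \<in> That t. p < i \<longrightarrow> g p < g i)" for i
    unfolding ball_That_Suc g_def by simp
  have right: "(\<forall>p \<in> That (Suc t). skip s i < p \<longrightarrow> h p < h (skip s i)) \<longleftrightarrow>
      (i < s \<longrightarrow> h s < g i) \<and> (\<forall>p \<in> That t. i < p \<longrightarrow> g p < g i)" for i
    unfolding ball_That_Suc g_def by simp
  \<comment> \<open>Column \<open>s\<close> can spoil left extremality only for the column right
    behind it at equal height; that height is even, so the condition holds there anyway.\<close>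
  have left': "s \<le> i \<longrightarrow> h s < g i \<or> even (g i)" if "\<forall>p \<in> That t. p < i \<longrightarrow> g p < g i" for i
    using that s_in(2) le even_s unfolding g_s[symmetric] by (metis le_less le_less_trans)
  have right': "i < s \<longrightarrow> h s < g i" if "\<forall>p \<in> That t. i < p \<longrightarrow> g p < g i" for i
    using that s_in(2) le unfolding g_s[symmetric] by (metis le_less_trans)
  have right_s: "\<not> (\<forall>p \<in> That (Suc t). s < p \<longrightarrow> h p < h s)"
    using le s by (auto intro!: bexI[of _ "Suc s"])
  have L: "(\<forall>i \<in> That (Suc t). (\<forall>p \<in> That (Suc t). p < i \<longrightarrow> h p < h i) \<longrightarrow>
        even (h i) \<or> (\<forall>l \<in> That (Suc t). h l \<le> h i)) \<longleftrightarrow>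
      (\<forall>i \<in> That t. (\<forall>p \<in> That t. p < i \<longrightarrow> g p < g i) \<longrightarrow> even (g i) \<or> (\<forall>l \<in> That t. g l \<le> g i))"
    unfolding ball_That_Suc[of "\<lambda>i. (\<forall>p \<in> That (Suc t). p < i \<longrightarrow> h p < h i) \<longrightarrow> _ i"] left max
    unfolding g_def[symmetric] using even_s left' by blast
  have R: "(\<forall>i \<in> That (Suc t). (\<forall>p \<in> That (Suc t). i < p \<longrightarrow> h p < h i) \<longrightarrow>
        odd (h i) \<or> (\<forall>l \<in> That (Suc t). h l \<le> h i)) \<longleftrightarrow>
      (\<forall>i \<in> That t. (\<forall>p \<in> That t. i < p \<longrightarrow> g p < g i) \<longrightarrow> odd (g i) \<or> (\<forall>l \<in> That t. g l \<le> g i))"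
    unfolding ball_That_Suc[of "\<lambda>i. (\<forall>p \<in> That (Suc t). i < p \<longrightarrow> h p < h i) \<longrightarrow> _ i"] right max
    unfolding g_def[symmetric] using right_s right' by blast
  show ?thesis
    unfolding diagram_iff L R using z by blast
qed

lemma left_neighbour_insert:
  assumes "left_neighbour t g j p q"
  shows "left_neighbour (Suc t) h j (skip s p) (target j q)"
proof -
  note pq = left_neighbourD[OF assms]
  have "h l < j" if l: "skip s p < l" "l < target j q" for l
  proof (cases l rule: skip_cases[of _ s])
    case 1
    then have q: "target j q = skip s q" "s \<le> q" "p < s" "q = s \<longrightarrow> h s < j"
      using l unfolding target_def by (auto split: if_splits)
    show ?thesis
    proof (cases "q = s")
      case True
      then show ?thesis using q 1 by simp
    next
      case False
      then have "g s < j"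
        using left_neighbour_between[OF assms, of s] q by simp
      then show ?thesis using 1 le g_s by simp
    qed
  next
    case (2 i)
    then have "p < i" "i < q"
      using l unfolding target_def by (auto split: if_splits)
    then show ?thesis
      using left_neighbour_between[OF assms] 2 unfolding g_def by simp
  qed
  moreover have "target j q \<in> That (Suc t)" "j \<le> h (target j q)" "skip s p < target j q"
    using pq s_in skip_in unfolding target_def g_def by (auto simp del: atLeastAtMost_iff)
  ultimately show ?thesis
    unfolding left_neighbour_iff using pq skip_in[of p] unfolding g_def by blast
qed

lemma left_neighbour_delete:
  assumes "left_neighbour (Suc t) h j P Q"
  obtains "P = s" "Q = Suc s" "j \<le> h s"
  | p q where "P = skip s p" "Q = target j q" "left_neighbour t g j p q"
proof -
  note PQ = left_neighbourD[OF assms]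
  show thesis
  proof (cases P rule: skip_cases[of _ s])
    case 1
    then have "j \<le> h s" using PQ by simp
    moreover have "Q = Suc s"
      using left_neighbour_between[OF assms, of "Suc s"] PQ 1 \<open>j \<le> h s\<close> le by force
    ultimately show thesis using that(1) 1 by blast
  next
    case (2 p)
    show thesis
    proof (cases Q rule: skip_cases[of _ s])
      case 1
      have "left_neighbour t g j p s"
        unfolding left_neighbour_iff
      proof (intro conjI allI impI)
        show "g l < j" if "p < l \<and> l < s" for l
          using left_neighbour_between[OF assms, of "skip s l"] that 1 2 unfolding g_def by simp
      qed (use PQ 1 2 s_in skip_in[of p] le g_s g_def in \<open>auto simp del: atLeastAtMost_iff skip_in\<close>)
      moreover have "Q = target j s"
        using PQ 1 unfolding target_def by simp
      ultimately show thesis using that(2) 2 by blast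
    next
      case q: (2 q)
      have "left_neighbour t g j p q"
        unfolding left_neighbour_iff
      proof (intro conjI allI impI)
        show "g l < j" if "p < l \<and> l < q" for l
          using left_neighbour_between[OF assms, of "skip s l"] that q 2 unfolding g_def by simp
      qed (use PQ q 2 skip_in[of p] skip_in[of q] g_def in \<open>auto simp del: atLeastAtMost_iff skip_in\<close>)
      moreover have "\<not> (q = s \<and> j \<le> h s)"
        using left_neighbour_between[OF assms, of s] PQ q 2 by auto
      then have "Q = target j q"
        using q unfolding target_def by auto
      ultimately show thesis using that(2) 2 by blast
    qed
  qed
qed

text \<open>The right end of a gap may jump from \<open>s\<close> to \<open>Suc s\<close> only above
  the even level \<open>h s\<close>, where labels pass through left ends. Where they pass through
  right ends, the target is stable.\<close>

lemma target_Suc: "odd j \<Longrightarrow> target (Suc j) q = target j q"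
  using even_s unfolding target_def by (cases "j = h s") auto

lemma gap_insert:
  "gap t g j p q a \<Longrightarrow> gap (Suc t) h j (skip s p) (target j q) (skip s a)"
proof (induction rule: gap.induct)
  case (base p)
  then have "skip s p \<in> T (Suc t)"
    using skip_in_T by blast
  moreover have "target 0 (Suc p) = Suc (skip s p)"
    unfolding target_def skip_def by auto
  ultimately show ?case
    using gap.base by metis
next
  case (even j p q' a q)
  then show ?case
    using gap.even left_neighbour_insert by metis
next
  case (odd j p' q a p)
  then show ?case
    using gap.odd left_neighbour_insert target_Suc by metis
qed

lemma gap_delete:
  assumes "gap (Suc t) h j P Q b"
  obtains "P = s" "Q = Suc s" "b = s"
  | p q a where "P = skip s p" "Q = target j q" "b = skip s a" "gap t g j p q a"
  using gap_left_neighbour[OF assms]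
proof (cases rule: left_neighbour_delete)
  case 1
  then have "gap (Suc t) h j P Q s"
    using gap_consecutive[OF s] le by simp
  then show ?thesis
    using gap_unique[OF assms] 1 that(1) by blast
next
  case (2 p q)
  obtain a where a: "gap t g j p q a"
    using gap_exists 2 by blast
  then show ?thesis
    using gap_insert[OF a] gap_unique[OF assms] 2 that(2) by blast
qed

lemma top_label_s: "top_label (Suc t) h s s"
  unfolding top_label_def using gap_consecutive[OF s, of "h s"] le even_s by auto

lemma top_label_insert:
  assumes "top_label t g i a"
  shows "top_label (Suc t) h (skip s i) (skip s a)"
proof (cases "even (g i)")
  case True
  then obtain q where "gap t g (g i) i q a"
    using assms unfolding top_label_def by auto
  then show ?thesis
    using gap_insert True unfolding top_label_def g_def by fastforce
next
  case False
  then obtain p where p: "gap t g (g i) p i a"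
    using assms unfolding top_label_def by auto
  \<comment> \<open>The target could be \<open>s\<close> only if \<open>g s = h s\<close>, which is
    impossible for an odd height.\<close>
  have "target (g i) i = skip s i"
    using False even_s le g_s unfolding target_def by (metis le_antisym)
  then show ?thesis
    using gap_insert[OF p] False unfolding top_label_def g_def by auto
qed

text \<open>It is the only column without a top label; the new column has one, and the others keep
  theirs.\<close>

lemma strongly_extremal_insert:
  assumes "diagram t g"
  shows "strongly_extremal (Suc t) h = skip s (strongly_extremal t g)"
proof -
  let ?e = "strongly_extremal (Suc t) h"
  have d: "diagram (Suc t) h"
    using assms diagram_iff_delete by blast
  have no: "\<not> top_label (Suc t) h ?e a" for a
    using top_label_exists_iff[OF d strongly_extremal_in] by blast
  then have "?e \<noteq> s"
    using top_label_s by metis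
  then obtain i where i: "?e = skip s i"
    using skip_cases by metis
  then have "i \<in> That t"
    using skip_in strongly_extremal_in by metis
  then have "i = strongly_extremal t g"
    using top_label_exists_iff[OF assms] top_label_insert no i by metis
  then show ?thesis using i by simp
qed

lemma label_sum_insert:
  assumes "diagram t g"
  shows "label_sum (Suc t) h C R = C s * R s + label_sum t g (\<lambda>a. C (skip s a)) (\<lambda>i. R (skip s i))"
proof -
  have d: "diagram (Suc t) h"
    using assms diagram_iff_delete by blast
  have eq: "label_value C (top_label (Suc t) h (skip s i)) =
      label_value (\<lambda>a. C (skip s a)) (top_label t g i)" if i: "i \<in> That t" for i
  proof (cases "i = strongly_extremal t g")
    case True
    then show ?thesis
      using label_value_strongly_extremal[OF d] label_value_strongly_extremal[OF assms]
        strongly_extremal_insert[OF assms] by metis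
  next
    case False
    then obtain a where "top_label t g i a"
      using top_label_exists_iff[OF assms i] by blast
    then show ?thesis
      using top_label_insert label_value_top_label by metis
  qed
  have "inj_on (skip s) (That t)"
    by (rule inj_onI) simp
  moreover have "s \<notin> skip s ` That t"
    by auto
  ultimately have "label_sum (Suc t) h C R = label_value C (top_label (Suc t) h s) * R s +
      (\<Sum>i\<in>That t. label_value C (top_label (Suc t) h (skip s i)) * R (skip s i))"
    unfolding label_sum_def That_Suc by (simp add: sum.reindex)
  then show ?thesis
    unfolding label_value_top_label[OF top_label_s] label_sum_def using eq by simp
qed

lemma target_le: "target j l \<le> target (Suc j) q \<longleftrightarrow> l \<le> q"
  unfolding target_def by (auto simp: skip_def)

section \<open>Compatibility and completeness under deletion and insertion\<close>

lemma compatible_delete: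
  assumes "compatible (Suc t) r h"
  shows "compatible t (delete_order s r) g"
  unfolding compatible_iff
proof (intro allI impI, elim conjE)
  fix j p q a l l' b
  assume gaps: "gap t g (Suc j) p q a" "gap t g j l l' b"
    and "p \<le> l" "l' \<le> q" and ne: "\<not> (if even j then l = p else l' = q)"
  have "\<not> (if even j then skip s l = skip s p else target j l' = target (Suc j) q)"
    using ne even_s unfolding target_def by (auto split: if_splits simp: le_Suc_eq)
  then have "(skip s a, skip s b) \<in> r"
    using assms[unfolded compatible_iff] gap_insert[OF gaps(1)] gap_insert[OF gaps(2)]
      \<open>p \<le> l\<close> \<open>l' \<le> q\<close> target_le skip_le by blast
  then show "(a, b) \<in> delete_order s r"
    unfolding delete_order_def by simp
qed

text \<open>A gap that absorbs the one labelled \<open>s\<close> has another label, which is smaller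
  by maximality. The gap labelled \<open>s\<close> absorbs nothing, its columns being adjacent. All
  other relations come from \<open>g\<close>.\<close>

lemma compatible_insert:
  assumes "compatible t (delete_order s r) g"
    and greatest: "\<And>a. a \<in> T (Suc t) \<Longrightarrow> a \<noteq> s \<Longrightarrow> (a, s) \<in> r"
  shows "compatible (Suc t) r h"
  unfolding compatible_iff
proof (intro allI impI, elim conjE)
  fix j P Q a L L' b
  assume big: "gap (Suc t) h (Suc j) P Q a" and small: "gap (Suc t) h j L L' b"
    and le: "P \<le> L" "L' \<le> Q" and ne: "\<not> (if even j then L = P else L' = Q)"
  note L = gap_left_neighbour[OF small]
  show "(a, b) \<in> r"
    using small
  proof (cases rule: gap_delete)
    case 1
    have "a \<noteq> s"
    proof
      assume "a = s"
      with big have "P = s \<and> Q = Suc s"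
        by (cases rule: gap_delete) auto
      then show False using ne 1 by (auto split: if_splits)
    qed
    then show ?thesis using greatest gap_label[OF big] 1 by simp
  next
    case small: (2 l l' b')
    show ?thesis
      using big
    proof (cases rule: gap_delete)
      case 1
      then have "s < L" "L' \<le> Suc s"
        using le small by (auto simp: le_less)
      then show ?thesis
        using left_neighbourD(3)[OF L] by simp
    next
      case big: (2 p q a')
      have "p \<le> l" "l' \<le> q"
        using le big small target_le by auto
      moreover have "\<not> (if even j then l = p else l' = q)"
        using ne big small target_Suc by auto
      ultimately have "(a', b') \<in> delete_order s r"
        using assms(1)[unfolded compatible_iff] big(4) small(4) by blast
      then show ?thesis
        using big small unfolding delete_order_def by simp
    qed
  qed
qed

lemma complete_delete:
  assumes "complete (Suc t) h"
  shows "complete t g"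
proof -
  have d: "diagram (Suc t) h" "diagram t g"
    using assms diagram_iff_delete unfolding complete_def by auto
  have "adjoinable (Suc t) h (skip s p)" if adj: "adjoinable t g p" for p
  proof -
    have p: "p \<in> That t" using adj unfolding adjoinable_def by blast
    have hp: "h (skip s p) = g p" unfolding g_def by simp
    show ?thesis
    proof (cases "even (g p)")
      case True
      obtain q where q: "p < q" "g p + 2 \<le> g q" "\<And>l. p < l \<Longrightarrow> l < q \<Longrightarrow> g l \<le> g p"
        using adjoinable_even[OF d(2) adj True] by blast
      have between: "h l \<le> g p" if "skip s p < l" "l < skip s q" "l \<noteq> s" for l
        using that q(3) by (cases l rule: skip_cases[of _ s]) (auto simp: g_def)
      have "\<exists>q > skip s p. g p + 2 \<le> h q \<and> (\<forall>l. skip s p < l \<and> l < q \<longrightarrow> h l \<le> g p)"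
      \<comment> \<open>If the new column blocks the view from \<open>p\<close> to \<open>q\<close>,
        it exceeds \<open>g p\<close> by at least two, both heights being even, and takes over the
        role of \<open>q\<close>.\<close>
      proof (cases "p < s \<and> s \<le> q \<and> g p < h s")
        case True
        have "h s \<noteq> Suc (g p)"
          using even_s \<open>even (g p)\<close> by auto
        then have "g p + 2 \<le> h s"
          using True by simp
        moreover have "h l \<le> g p" if "skip s p < l" "l < s" for l
          using between[of l] that True by (metis less_trans order_less_irrefl self_less_skip)
        ultimately show ?thesis
          using True by (intro exI[of _ s]) auto
      next
        case False
        then have "h l \<le> g p" if "skip s p < l" "l < skip s q" for l
          using between[OF that] that by (cases "l = s") auto
        then show ?thesis
          using q by (intro exI[of _ "skip s q"]) (auto simp: g_def)
      qed
      then show ?thesis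
        unfolding adjoinable_iff[OF d(1)] hp using True p skip_in by blast
    next
      case False
      obtain q where q: "q < p" "g p + 2 \<le> g q" "\<And>l. q < l \<Longrightarrow> l < p \<Longrightarrow> g l \<le> g p"
        using adjoinable_odd[OF d(2) adj False] by blast
      \<comment> \<open>Column \<open>s\<close> of \<open>g\<close> lies in the viewed range too,
        possibly as \<open>p\<close> itself, and is at least as high as the new column.\<close>
      have "h s \<le> g p" if "q < s" "s \<le> p"
        using that q(3)[of s] le g_s by (cases "s = p") auto
      then have "h l \<le> g p" if "skip s q < l" "l < skip s p" for l
        using that q(3) by (cases l rule: skip_cases[of _ s]) (auto simp: g_def)
      then have "\<exists>q < skip s p. g p + 2 \<le> h q \<and> (\<forall>l. q < l \<and> l < skip s p \<longrightarrow> h l \<le> g p)"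
        using q by (intro exI[of _ "skip s q"]) (auto simp: g_def)
      then show ?thesis
        unfolding adjoinable_iff[OF d(1)] hp using False p skip_in by blast
    qed
  qed
  then show ?thesis
    using assms d unfolding complete_def by blast
qed

text \<open>If column \<open>Suc s\<close> exceeded the new column by two or more, the new column
  would itself admit a left domino; \<open>top\<close> rules this out. In every other case the
  higher column behind it leads to a domino of \<open>g\<close>.\<close>

lemma complete_insert:
  assumes "complete t g" and top: "h (Suc s) \<le> Suc (h s)"
  shows "complete (Suc t) h"
proof -
  have d: "diagram (Suc t) h" "diagram t g"
    using assms diagram_iff_delete unfolding complete_def by auto
  have "\<exists>p. adjoinable t g p" if adj: "adjoinable (Suc t) h P" for P
  proof (cases P rule: skip_cases[of _ s])
    case 1
    then obtain q where q: "s < q" "h s + 2 \<le> h q" "\<And>l. s < l \<Longrightarrow> l < q \<Longrightarrow> h l \<le> h s"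
      using adjoinable_even[OF d(1)] adj even_s by blast
    \<comment> \<open>The view from the new column therefore crosses column \<open>Suc s\<close>,
      which has equal height and admits the same domino in \<open>g\<close>.\<close>
    have "q \<noteq> Suc s" using q top by auto
    then have "g s = h s"
      using q(1) q(3)[of "Suc s"] le g_s by simp
    moreover obtain q' where q': "q = skip s q'"
      using q(1) by (cases q rule: skip_cases[of _ s]) auto
    moreover have "s < q'"
      using q(1) \<open>q \<noteq> Suc s\<close> q' unfolding skip_def by (auto split: if_splits)
    moreover have "g l \<le> h s" if "s < l" "l < q'" for l
      using q(3)[of "skip s l"] that q' unfolding g_def by simp
    ultimately have "adjoinable t g s"
      unfolding adjoinable_iff[OF d(2)] using even_s q(2) s_in(2) g_def[of q'] by auto
    then show ?thesis ..
  next
    case (2 p)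
    have p: "p \<in> That t" using adj 2 skip_in unfolding adjoinable_def by blast
    have hp: "h P = g p" unfolding g_def 2 by simp
    have "adjoinable t g p"
    proof (cases "even (g p)")
      case True
      obtain q where q: "P < q" "g p + 2 \<le> h q" "\<And>l. P < l \<Longrightarrow> l < q \<Longrightarrow> h l \<le> g p"
        using adjoinable_even[OF d(1) adj] True unfolding hp by blast
      have "\<exists>q > p. g p + 2 \<le> g q \<and> (\<forall>l. p < l \<and> l < q \<longrightarrow> g l \<le> g p)"
      proof (cases q rule: skip_cases[of _ s])
        case 1
        have "g l \<le> g p" if "p < l" "l < s" for l
          using q(3)[of "skip s l"] that 1 2 unfolding g_def by simp
        then show ?thesis
          using 1 2 q le g_s by (intro exI[of _ s]) auto
      next
        case q': (2 q')
        have "g l \<le> g p" if "p < l" "l < q'" for l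
          using q(3)[of "skip s l"] that q' 2 unfolding g_def by simp
        then show ?thesis
          using q' 2 q by (intro exI[of _ q']) (auto simp: g_def)
      qed
      then show ?thesis
        unfolding adjoinable_iff[OF d(2)] using True p by blast
    next
      case False
      obtain q where q: "q < P" "g p + 2 \<le> h q" "\<And>l. q < l \<Longrightarrow> l < P \<Longrightarrow> h l \<le> g p"
        using adjoinable_odd[OF d(1) adj] False unfolding hp by blast
      \<comment> \<open>Column \<open>Suc s\<close> is at least as high as column \<open>s\<close>,
        and it is either \<open>P\<close> itself or obstructs the view.\<close>
      have "q \<noteq> s"
      proof
        assume "q = s"
        then have "p = s \<or> h (Suc s) \<le> g p"
          using q(1) q(3)[of "Suc s"] 2 unfolding skip_def by (cases "s < p") (auto split: if_splits)
        then show False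
          using q(2) le g_s \<open>q = s\<close> by auto
      qed
      then obtain q' where q': "q = skip s q'"
        using skip_cases by metis
      have "g l \<le> g p" if "q' < l" "l < p" for l
        using q(3)[of "skip s l"] that q' 2 unfolding g_def by simp
      then have "\<exists>q < p. g p + 2 \<le> g q \<and> (\<forall>l. q < l \<and> l < p \<longrightarrow> g l \<le> g p)"
        using q' 2 q by (intro exI[of _ q']) (auto simp: g_def)
      then show ?thesis
        unfolding adjoinable_iff[OF d(2)] using False p by blast
    qed
    then show ?thesis ..
  qed
  then show ?thesis
    using assms d unfolding complete_def by blast
qed

end


subsection \<open>Increasing paths\<close>

lemma column_insertion_delete:
  assumes "diagram (Suc t) h" "s \<in> T (Suc t)" "even (h s)" "h s \<le> h (Suc s)"
  shows "column_insertion t s h"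
  using assms unfolding column_insertion_def diagram_def by auto

text \<open>The largest admissible even height is chosen for the new column to preserve completeness.\<close>

definition insert_column :: "nat \<Rightarrow> (nat \<Rightarrow> nat) \<Rightarrow> nat \<Rightarrow> nat" where
  "insert_column s g i = (if i < s then g i else if i = s then 2 * (g s div 2) else g (i - 1))"

lemma column_insertion_insert_column:
  assumes "diagram t g" "s \<in> T (Suc t)"
  shows "column_insertion t s (insert_column s g)"
proof
  show "insert_column s g i = 0" if "i \<notin> That (Suc t)" for i
  proof -
    have "i < s \<Longrightarrow> i \<notin> That t" "s < i \<Longrightarrow> i - 1 \<notin> That t" "i \<noteq> s"
      using that assms(2) by auto
    then show ?thesis
      using assms(1) unfolding insert_column_def diagram_def by auto
  qed
qed (use assms(2) in \<open>auto simp: insert_column_def\<close>)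

lemma delete_insert_column:
  "column_insertion.g s (insert_column s g) = g" if "column_insertion t s (insert_column s g)"
  unfolding column_insertion.g_def[OF that] by (auto simp: insert_column_def skip_def fun_eq_iff)

section \<open>Complete compatible diagrams and their two extensions\<close>

definition good :: "nat \<Rightarrow> (nat \<times> nat) set \<Rightarrow> (nat \<Rightarrow> nat) \<Rightarrow> bool" where
  "good t r h \<longleftrightarrow> complete t h \<and> compatible t r h"

lemma good_diagram: "good t r h \<Longrightarrow> diagram t h"
  unfolding good_def complete_def by blast

lemma good_mono: "good t r h \<Longrightarrow> r \<subseteq> r' \<Longrightarrow> good t r' h"
  unfolding good_def compatible_def by blast

lemma good_dual: "good t r h \<Longrightarrow> good t (dual_order t r) (dual t h)"
  unfolding good_def using complete_dual compatible_dual by blast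

lemma dual_order_dual_order: "dual_order t (dual_order t r) \<subseteq> r"
  unfolding dual_order_def by auto

lemma good_insert_left:
  assumes "good t (delete_order s r) g" "s \<in> T (Suc t)"
    and "\<And>a. a \<in> T (Suc t) \<Longrightarrow> a \<noteq> s \<Longrightarrow> (a, s) \<in> r"
  shows "\<exists>h. good (Suc t) r h \<and>
    strongly_extremal (Suc t) h = skip s (strongly_extremal t g) \<and>
    (\<forall>(C :: nat \<Rightarrow> 'r::comm_ring_1) R. label_sum (Suc t) h C R =
       C s * R s + label_sum t g (\<lambda>a. C (skip s a)) (\<lambda>i. R (skip s i)))"
proof -
  interpret column_insertion t s "insert_column s g"
    using column_insertion_insert_column[OF good_diagram[OF assms(1)] assms(2)] .
  have eq: "column_insertion.g s (insert_column s g) = g"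
    using delete_insert_column column_insertion_axioms .
  have "n \<le> Suc (2 * (n div 2))" for n :: nat
    by presburger
  then have "insert_column s g (Suc s) \<le> Suc (insert_column s g s)"
    unfolding insert_column_def by simp
  then have "good (Suc t) r (insert_column s g)"
    using complete_insert compatible_insert assms unfolding eq good_def by blast
  then show ?thesis
    using strongly_extremal_insert label_sum_insert good_diagram[OF assms(1)] unfolding eq by blast
qed

text \<open>\<open>R\<close> is free at the strongly extremal column. Hence \<open>skip s\<close>
  and \<open>skip (Suc s)\<close>, which differ only at \<open>s\<close>, yield equal sums when
  column \<open>s\<close> is strongly extremal.\<close>

lemma label_sum_cong:
  assumes "\<And>a. a \<in> T t \<Longrightarrow> C a = C' a"
    and "\<And>i a. top_label t h i a \<Longrightarrow> R i = R' i"
  shows "label_sum t h C R = label_sum t h C' R'"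
  unfolding label_sum_def
proof (rule sum.cong[OF refl])
  fix i
  show "label_value C (top_label t h i) * R i = label_value C' (top_label t h i) * R' i"
  proof (cases "\<exists>a. top_label t h i a")
    case True
    then obtain a where a: "top_label t h i a" by blast
    then show ?thesis
      unfolding label_value_top_label[OF a] using assms(1)[of a] assms(2)[OF a] top_label_in[OF a]
      by simp
  next
    case False
    then show ?thesis by (simp add: label_value_none)
  qed
qed

text \<open>
  The new column has odd height here. Going through the dual raises all other columns by two levels,
  so that a positive odd height is available even if column \<open>s\<close> is empty.
\<close>

lemma good_insert_right:
  assumes g: "good t (delete_order s r) g" and s: "s \<in> T (Suc t)"
    and max: "\<And>a. a \<in> T (Suc t) \<Longrightarrow> a \<noteq> s \<Longrightarrow> (a, s) \<in> r"
  shows "\<exists>h. good (Suc t) r h \<and>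
    strongly_extremal (Suc t) h = skip (Suc s) (strongly_extremal t g) \<and>
    (\<forall>(C :: nat \<Rightarrow> 'r::comm_ring_1) R. label_sum (Suc t) h C R =
       C s * R (Suc s) + label_sum t g (\<lambda>a. C (skip s a)) (\<lambda>i. R (skip (Suc s) i)))"
proof -
  \<comment> \<open>Labels reflect around \<open>Suc t + 1\<close> and columns around
    \<open>Suc t + 2\<close>, so column \<open>s'\<close> of the dual becomes column
    \<open>Suc s\<close>.\<close>
  define s' where "s' = Suc t + 1 - s"
  have s': "s' \<in> T (Suc t)" "Suc t + 1 - s' = s" "Suc t + 2 - s' = Suc s"
    using s unfolding s'_def by auto
  have label: "Suc t + 1 - skip s' a = skip s (t + 1 - a)" if "a \<in> T t" for a
    using that s unfolding skip_def s'_def by auto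
  have column: "Suc t + 2 - skip s' i = skip (Suc s) (t + 2 - i)" if "i \<in> That t" for i
    using that s unfolding skip_def s'_def by auto
  have in_T: "skip s' a \<in> T (Suc t)" if "a \<in> T t" for a
    using that unfolding skip_def by auto
  have "dual_order t (delete_order s r) \<subseteq> delete_order s' (dual_order (Suc t) r)"
    unfolding dual_order_def delete_order_def using label in_T by auto
  then have g': "good t (delete_order s' (dual_order (Suc t) r)) (dual t g)"
    using good_mono good_dual[OF g] by blast
  have "(a, s') \<in> dual_order (Suc t) r" if "a \<in> T (Suc t)" "a \<noteq> s'" for a
  proof -
    have "Suc t + 1 - a \<in> T (Suc t)" "Suc t + 1 - a \<noteq> s"
      using that s' by auto
    then show ?thesis
      using max that s' unfolding dual_order_def by auto
  qed
  from good_insert_left[where 'r = 'r, OF g' s'(1) this]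
  obtain h where h: "good (Suc t) (dual_order (Suc t) r) h"
    "strongly_extremal (Suc t) h = skip s' (strongly_extremal t (dual t g))"
    "\<And>(C :: nat \<Rightarrow> 'r) R. label_sum (Suc t) h C R =
       C s' * R s' + label_sum t (dual t g) (\<lambda>a. C (skip s' a)) (\<lambda>i. R (skip s' i))"
    by blast
  have "good (Suc t) r (dual (Suc t) h)"
    using good_mono[OF good_dual[OF h(1)] dual_order_dual_order] .
  moreover have "strongly_extremal (Suc t) (dual (Suc t) h) = skip (Suc s) (strongly_extremal t g)"
    unfolding strongly_extremal_dual h(2) using column[OF mirror_in] strongly_extremal_in[of t g] by simp
  moreover have "label_sum (Suc t) (dual (Suc t) h) C R =
       C s * R (Suc s) + label_sum t g (\<lambda>a. C (skip s a)) (\<lambda>i. R (skip (Suc s) i))"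
    for C :: "nat \<Rightarrow> 'r" and R
  proof -
    have "label_sum (Suc t) (dual (Suc t) h) C R = C s * R (Suc s) +
      label_sum t g (\<lambda>a. C (Suc t + 1 - skip s' (t + 1 - a))) (\<lambda>i. R (Suc t + 2 - skip s' (t + 2 - i)))"
      unfolding label_sum_dual[OF good_diagram[OF h(1)]] h(3) label_sum_dual[OF good_diagram[OF g]] s' ..
    also have "label_sum t g (\<lambda>a. C (Suc t + 1 - skip s' (t + 1 - a)))
        (\<lambda>i. R (Suc t + 2 - skip s' (t + 2 - i))) =
      label_sum t g (\<lambda>a. C (skip s a)) (\<lambda>i. R (skip (Suc s) i))"
    proof (rule label_sum_cong)
      show "C (Suc t + 1 - skip s' (t + 1 - a)) = C (skip s a)" if "a \<in> T t" for a
      proof -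
        have "t + 1 - a \<in> T t" "t + 1 - (t + 1 - a) = a"
          using that by auto
        then show ?thesis using label by metis
      qed
      show "R (Suc t + 2 - skip s' (t + 2 - i)) = R (skip (Suc s) i)" if "top_label t g i a" for i a
      proof -
        have "t + 2 - i \<in> That t" "t + 2 - (t + 2 - i) = i"
          using top_label_in[OF that] by auto
        then show ?thesis using column by metis
      qed
    qed
    finally show ?thesis .
  qed
  ultimately show ?thesis by blast
qed

section \<open>Paths between strongly extremal columns\<close>

definition increasing_path ::
  "nat \<Rightarrow> (nat \<times> nat) set \<Rightarrow> nat \<Rightarrow> nat \<Rightarrow> nat \<Rightarrow> (nat \<Rightarrow> nat) \<Rightarrow> (nat \<Rightarrow> nat) \<Rightarrow> bool" where
  "increasing_path t r j k n u v \<longleftrightarrow> 1 \<le> n \<and> (\<forall>i\<in>{1..<n}. u i \<in> T t) \<and>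
     (\<forall>i\<in>{1..n}. v i \<in> That t) \<and> v 1 = j \<and> v n = k \<and>
     (\<forall>i. 1 \<le> i \<and> i + 1 < n \<longrightarrow> (u i, u (i + 1)) \<in> r)"

text \<open>The difference is reversed compared with condition S because label sums enter the
  functions with a minus sign. The \<open>itself\<close> argument fixes the ring over which the
  identity is quantified.\<close>

definition reachable :: "'r::comm_ring_1 itself \<Rightarrow> nat \<Rightarrow> (nat \<times> nat) set \<Rightarrow> (nat \<Rightarrow> nat) \<Rightarrow> nat \<Rightarrow> bool" where
  "reachable _ t r h' k \<longleftrightarrow>
     (\<exists>h n u v. good t r h \<and> strongly_extremal t h = k \<and>
        increasing_path t r (strongly_extremal t h') k n u v \<and>
        (\<forall>(C :: nat \<Rightarrow> 'r::comm_ring_1) R. label_sum t h C R - label_sum t h' C R =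
           (\<Sum>i\<in>{1..<n}. C (u i) * (R (v i) - R (v (i + 1))))))"

lemma reachableI:
  fixes ty :: "'r::comm_ring_1 itself"
  assumes "good t r h" "strongly_extremal t h = k"
    and "increasing_path t r (strongly_extremal t h') k n u v"
    and "\<And>(C :: nat \<Rightarrow> 'r) R. label_sum t h C R - label_sum t h' C R =
           (\<Sum>i\<in>{1..<n}. C (u i) * (R (v i) - R (v (i + 1))))"
  shows "reachable ty t r h' k"
  unfolding reachable_def using assms by blast

text \<open>This reduces the case in which column \<open>Suc s\<close> ends at an odd height to the
  one in which a column ends at an even height.\<close>

lemma reachable_dual:
  fixes ty :: "'r::comm_ring_1 itself"
  assumes "good t r h'" "reachable ty t (dual_order t r) (dual t h') (t + 2 - k)" "k \<in> That t"
  shows "reachable ty t r h' k"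
proof -
  obtain h n u v where h: "good t (dual_order t r) h" "strongly_extremal t h = t + 2 - k"
    and path: "increasing_path t (dual_order t r) (t + 2 - strongly_extremal t h') (t + 2 - k) n u v"
    and eq: "\<And>(C :: nat \<Rightarrow> 'r) R. label_sum t h C R - label_sum t (dual t h') C R =
           (\<Sum>i\<in>{1..<n}. C (u i) * (R (v i) - R (v (i + 1))))"
    using assms(2) unfolding reachable_def strongly_extremal_dual by blast
  have "good t r (dual t h)"
    using good_mono[OF good_dual[OF h(1)] dual_order_dual_order] .
  moreover have "strongly_extremal t (dual t h) = k"
    unfolding strongly_extremal_dual h(2) using assms(3) by auto
  moreover have "increasing_path t r (strongly_extremal t h') k n (\<lambda>i. t + 1 - u i) (\<lambda>i. t + 2 - v i)"
    unfolding increasing_path_def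
  proof (intro conjI ballI allI impI)
    show "1 \<le> n" using path unfolding increasing_path_def by simp
    show "t + 1 - u i \<in> T t" if "i \<in> {1..<n}" for i
    proof -
      have "u i \<in> T t"
        using path that unfolding increasing_path_def by blast
      then show ?thesis by auto
    qed
    show "t + 2 - v i \<in> That t" if "i \<in> {1..n}" for i
      using path that mirror_in unfolding increasing_path_def by blast
    show "t + 2 - v 1 = strongly_extremal t h'"
      using path strongly_extremal_in[of t h'] unfolding increasing_path_def by auto
    show "t + 2 - v n = k"
      using path assms(3) unfolding increasing_path_def by auto
    show "(t + 1 - u i, t + 1 - u (i + 1)) \<in> r" if "1 \<le> i \<and> i + 1 < n" for i
      using path that unfolding increasing_path_def dual_order_def by blast
  qed
  moreover have "label_sum t (dual t h) C R - label_sum t h' C R =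
      (\<Sum>i\<in>{1..<n}. C (t + 1 - u i) * (R (t + 2 - v i) - R (t + 2 - v (i + 1))))"
    for C :: "nat \<Rightarrow> 'r" and R
  proof -
    have "label_sum t h' C R = label_sum t (dual t h') (\<lambda>a. C (t + 1 - a)) (\<lambda>i. R (t + 2 - i))"
      unfolding label_sum_dual[OF good_diagram[OF assms(1)]]
      by (rule label_sum_cong) (auto dest: top_label_in)
    then show ?thesis
      unfolding label_sum_dual[OF good_diagram[OF h(1)]] using eq by simp
  qed
  ultimately show ?thesis
    by (rule reachableI)
qed

lemma strict_linear_order_delete:
  assumes "strict_linear_order_on (T (Suc t)) r" "s \<in> T (Suc t)"
  shows "strict_linear_order_on (T t) (delete_order s r)"
proof -
  have "trans r" "irrefl r" "total_on (T (Suc t)) r"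
    using assms unfolding strict_linear_order_on_def by auto
  note r = this[unfolded trans_def irrefl_def total_on_def]
  have "trans (delete_order s r)" "irrefl (delete_order s r)"
    using r(1,2) unfolding trans_def irrefl_def delete_order_def by blast+
  moreover have "total_on (T t) (delete_order s r)"
    unfolding total_on_def
  proof (intro ballI impI)
    fix a b assume ab: "a \<in> T t" "b \<in> T t" "a \<noteq> b"
    then have "skip s a \<in> T (Suc t)" "skip s b \<in> T (Suc t)" "skip s a \<noteq> skip s b"
      unfolding skip_def by auto
    then show "(a, b) \<in> delete_order s r \<or> (b, a) \<in> delete_order s r"
      using r(3) unfolding delete_order_def by blast
  qed
  ultimately show ?thesis
    unfolding strict_linear_order_on_def by blast
qed

lemma reachable_step:
  fixes ty :: "'r::comm_ring_1 itself"
  assumes IH: "\<And>g k. good t (delete_order s r) g \<Longrightarrow> k \<in> That t \<Longrightarrow> reachable ty t (delete_order s r) g k"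
    and h': "good (Suc t) r h'" and s: "s \<in> T (Suc t)"
    and max: "\<And>a. a \<in> T (Suc t) \<Longrightarrow> a \<noteq> s \<Longrightarrow> (a, s) \<in> r"
    and cols: "even (h' s)" "h' s \<le> h' (Suc s)" and k: "k \<in> That (Suc t)"
  shows "reachable ty (Suc t) r h' k"
proof -
  interpret column_insertion t s h'
    using column_insertion_delete[OF good_diagram[OF h'] s cols] .
  have g: "good t (delete_order s r) g"
    using h' complete_delete compatible_delete unfolding good_def by blast
  note d = good_diagram[OF g]
  \<comment> \<open>For \<open>k = s\<close> no column is mapped to \<open>k\<close>; then
    \<open>k' = s\<close>, the column whose images in the two extensions differ.\<close>
  define k' where "k' = (if k \<le> s then k else k - 1)"
  have k': "k' \<in> That t" "k \<noteq> s \<Longrightarrow> k = skip s k'"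
    using k s unfolding k'_def skip_def by auto
  obtain g1 n u v where g1: "good t (delete_order s r) g1" "strongly_extremal t g1 = k'"
    and path: "increasing_path t (delete_order s r) (strongly_extremal t g) k' n u v"
    and eq: "\<And>(C :: nat \<Rightarrow> 'r) R. label_sum t g1 C R - label_sum t g C R =
           (\<Sum>i\<in>{1..<n}. C (u i) * (R (v i) - R (v (i + 1))))"
    using IH[OF g k'(1)] unfolding reachable_def by blast
  have path': "increasing_path (Suc t) r (strongly_extremal (Suc t) h') (skip s k') n
      (\<lambda>i. skip s (u i)) (\<lambda>i. skip s (v i))"
    unfolding increasing_path_def
  proof (intro conjI ballI allI impI)
    show "1 \<le> n" using path unfolding increasing_path_def by blast
    show "skip s (u i) \<in> T (Suc t)" if "i \<in> {1..<n}" for i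
      using path that skip_in_T unfolding increasing_path_def by blast
    show "skip s (v i) \<in> That (Suc t)" if "i \<in> {1..n}" for i
      using path that skip_in unfolding increasing_path_def by blast
    show "skip s (v 1) = strongly_extremal (Suc t) h'" "skip s (v n) = skip s k'"
      using path strongly_extremal_insert[OF d] unfolding increasing_path_def by auto
    show "(skip s (u i), skip s (u (i + 1))) \<in> r" if "1 \<le> i \<and> i + 1 < n" for i
      using path that unfolding increasing_path_def delete_order_def by blast
  qed
  show ?thesis
  proof (cases "k = s")
    case False
    obtain h where h: "good (Suc t) r h" "strongly_extremal (Suc t) h = k"
      and sum: "\<And>(C :: nat \<Rightarrow> 'r) R. label_sum (Suc t) h C R =
        C s * R s + label_sum t g1 (\<lambda>a. C (skip s a)) (\<lambda>i. R (skip s i))"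
      using good_insert_left[where 'r = 'r, OF g1(1) s max] g1(2) k'(2)[OF False] by auto
    have "label_sum (Suc t) h C R - label_sum (Suc t) h' C R =
        (\<Sum>i\<in>{1..<n}. C (skip s (u i)) * (R (skip s (v i)) - R (skip s (v (i + 1)))))"
      for C :: "nat \<Rightarrow> 'r" and R
      unfolding sum label_sum_insert[OF d] using eq by simp
    from reachableI[OF h path'[folded k'(2)[OF False]] this] show ?thesis .
  next
    case True
    then have "k' = s" unfolding k'_def by simp
    obtain h where h: "good (Suc t) r h" "strongly_extremal (Suc t) h = k"
      and sum: "\<And>(C :: nat \<Rightarrow> 'r) R. label_sum (Suc t) h C R =
        C s * R (Suc s) + label_sum t g1 (\<lambda>a. C (skip s a)) (\<lambda>i. R (skip (Suc s) i))"
      using good_insert_right[where 'r = 'r, OF g1(1) s max] g1(2) True \<open>k' = s\<close>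
      by (auto simp: skip_def[of "Suc s" s])
    have sum': "label_sum (Suc t) h C R =
        C s * R (Suc s) + label_sum t g1 (\<lambda>a. C (skip s a)) (\<lambda>i. R (skip s i))"
      for C :: "nat \<Rightarrow> 'r" and R
    proof -
      have "R (skip (Suc s) i) = R (skip s i)" if "top_label t g1 i a" for i a
      proof -
        have "i \<noteq> s"
          using top_label_exists_iff[OF good_diagram[OF g1(1)], of i] top_label_in[OF that] that
            g1(2) \<open>k' = s\<close> by blast
        then show ?thesis unfolding skip_def by auto
      qed
      then have "label_sum t g1 (\<lambda>a. C (skip s a)) (\<lambda>i. R (skip (Suc s) i)) =
          label_sum t g1 (\<lambda>a. C (skip s a)) (\<lambda>i. R (skip s i))"
        by (intro label_sum_cong) auto
      then show ?thesis unfolding sum by simp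
    qed
    \<comment> \<open>The lifted path ends in \<open>skip s s = Suc s\<close>. The appended step
      with label \<open>s\<close> accounts for that label sitting at column \<open>Suc s\<close> in
      \<open>h\<close> but at column \<open>s\<close> in \<open>h'\<close>.\<close>
    define u' where "u' i = (if i = n then s else skip s (u i))" for i
    define v' where "v' i = (if i = Suc n then s else skip s (v i))" for i
    have "skip s (v n) = Suc s"
      using path' \<open>k' = s\<close> unfolding increasing_path_def by (simp add: skip_def)
    then have "label_sum (Suc t) h C R - label_sum (Suc t) h' C R =
        (\<Sum>i\<in>{1..<n}. C (skip s (u i)) * (R (skip s (v i)) - R (skip s (v (i + 1))))) +
        C (u' n) * (R (v' n) - R (v' (n + 1)))"
      for C :: "nat \<Rightarrow> 'r" and R
      unfolding sum' label_sum_insert[OF d]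
        eq[of "\<lambda>a. C (skip s a)" "\<lambda>i. R (skip s i)", symmetric] u'_def v'_def by (simp add: algebra_simps)
    moreover have "(\<Sum>i\<in>{1..<n}. C (skip s (u i)) * (R (skip s (v i)) - R (skip s (v (i + 1))))) =
        (\<Sum>i\<in>{1..<n}. C (u' i) * (R (v' i) - R (v' (i + 1))))" for C R :: "nat \<Rightarrow> 'r"
      by (rule sum.cong) (auto simp: u'_def v'_def)
    moreover have "1 \<le> n"
      using path unfolding increasing_path_def by simp
    ultimately have "label_sum (Suc t) h C R - label_sum (Suc t) h' C R =
        (\<Sum>i\<in>{1..<Suc n}. C (u' i) * (R (v' i) - R (v' (i + 1))))" for C R :: "nat \<Rightarrow> 'r"
      by simp
    moreover have "increasing_path (Suc t) r (strongly_extremal (Suc t) h') k (Suc n) u' v'"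
      unfolding increasing_path_def
    proof (intro conjI ballI allI impI)
      show "u' i \<in> T (Suc t)" if "i \<in> {1..<Suc n}" for i
        using path' that s unfolding increasing_path_def u'_def by (cases "i = n") auto
      show "v' i \<in> That (Suc t)" if "i \<in> {1..Suc n}" for i
        using path' that s_in unfolding increasing_path_def v'_def by (cases "i = Suc n") auto
      show "v' 1 = strongly_extremal (Suc t) h'" "v' (Suc n) = k"
        using path' True \<open>1 \<le> n\<close> unfolding increasing_path_def v'_def by auto
      show "(u' i, u' (i + 1)) \<in> r" if i: "1 \<le> i \<and> i + 1 < Suc n" for i
      proof (cases "i + 1 = n")
        case True
        then have "skip s (u i) \<in> T (Suc t)"
          using path' i unfolding increasing_path_def by simp
        then show ?thesis
          using max[of "skip s (u i)"] True unfolding u'_def by simp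
      next
        case False
        then show ?thesis
          using path' i unfolding increasing_path_def u'_def by simp
      qed
    qed simp
    ultimately show ?thesis
      using reachableI[OF h] by blast
  qed
qed

lemma greatest_exists:
  assumes "strict_linear_order_on (T (Suc t)) r"
  obtains s where "s \<in> T (Suc t)" "\<And>a. a \<in> T (Suc t) \<Longrightarrow> a \<noteq> s \<Longrightarrow> (a, s) \<in> r"
proof -
  have r: "trans r" "total_on (T (Suc t)) r"
    using assms unfolding strict_linear_order_on_def by auto
  have "\<exists>s \<in> A. \<forall>a \<in> A. a \<noteq> s \<longrightarrow> (a, s) \<in> r" if "finite A" "A \<noteq> {}" "A \<subseteq> T (Suc t)" for A
    using that
  proof (induction rule: finite_ne_induct)
    case (insert x A)
    then obtain s where s: "s \<in> A" "\<forall>a \<in> A. a \<noteq> s \<longrightarrow> (a, s) \<in> r"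
      by auto
    then have "(x, s) \<in> r \<or> (s, x) \<in> r"
      using r(2) insert unfolding total_on_def by (metis insert_subset subset_iff)
    then show ?case
    proof
      assume "(x, s) \<in> r"
      then show ?thesis using s by auto
    next
      assume sx: "(s, x) \<in> r"
      then have "(a, x) \<in> r" if "a \<in> A" for a
        using s(2) that r(1) by (metis transD)
      then show ?thesis by auto
    qed
  qed simp
  from this[of "T (Suc t)"] show ?thesis
    using that by auto
qed

lemma reachable_all:
  fixes ty :: "'r::comm_ring_1 itself"
  assumes "strict_linear_order_on (T t) r" "good t r h" "k \<in> That t"
  shows "reachable ty t r h k"
  using assms
proof (induction t arbitrary: r h k)
  case 0
  \<comment> \<open>There is a single column, so the path has no steps and the label function is
    never evaluated.\<close>
  have "increasing_path 0 r (strongly_extremal 0 h) k 1 (\<lambda>_. 0) (\<lambda>_. k)"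
    using 0 strongly_extremal_in[of 0 h] unfolding increasing_path_def by auto
  then show ?case
    using 0 strongly_extremal_in[of 0 h] by (intro reachableI[where n = 1]) auto
next
  case (Suc t)
  \<comment> \<open>The order and the diagram are kept general so that this also applies to the
    dual.\<close>
  have step: "reachable ty (Suc t) r h k"
    if "strict_linear_order_on (T (Suc t)) r" "good (Suc t) r h" "k \<in> That (Suc t)"
      "s \<in> T (Suc t)" "\<And>a. a \<in> T (Suc t) \<Longrightarrow> a \<noteq> s \<Longrightarrow> (a, s) \<in> r" "even (h s)" "h s \<le> h (Suc s)"
    for r h k s
    using reachable_step[OF Suc.IH[OF strict_linear_order_delete[OF that(1,4)]] that(2,4,5,6,7,3)] .
  obtain s where s: "s \<in> T (Suc t)" "\<And>a. a \<in> T (Suc t) \<Longrightarrow> a \<noteq> s \<Longrightarrow> (a, s) \<in> r"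
    using greatest_exists[OF Suc.prems(1)] by blast
  have least: "(s, a) \<notin> r" if "a \<in> T (Suc t)" for a
    using Suc.prems(1) s(2)[OF that] unfolding strict_linear_order_on_def irrefl_def
    by (metis transD)
  consider "even (h s) \<and> h s \<le> h (Suc s)" | "odd (h (Suc s)) \<and> h (Suc s) \<le> h s"
    using greatest_label_columns[OF good_diagram[OF Suc.prems(2)] _ least s(1)] Suc.prems(2)
    unfolding good_def by blast
  then show ?case
  proof cases
    case 1
    then show ?thesis
      using step[OF Suc.prems s] by blast
  next
    case 2
    \<comment> \<open>Column \<open>Suc s\<close> reflects to \<open>s'\<close>, and the added row
      makes its odd height even, so the dual falls under the first case.\<close>
    define s' where "s' = Suc t + 1 - s"
    have s': "s' \<in> T (Suc t)" "Suc t + 1 - s' = s" "s' = Suc t + 2 - Suc s" "Suc s' = Suc t + 2 - s"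
      using s(1) unfolding s'_def by auto
    have greatest: "(a, s') \<in> dual_order (Suc t) r" if "a \<in> T (Suc t)" "a \<noteq> s'" for a
    proof -
      have "Suc t + 1 - a \<in> T (Suc t)" "Suc t + 1 - a \<noteq> s"
        using that s' by auto
      then show ?thesis
        using s(2) that s' unfolding dual_order_def by auto
    qed
    have in_That: "s \<in> That (Suc t)" "Suc s \<in> That (Suc t)"
      using s(1) by auto
    have "even (dual (Suc t) h s')" "dual (Suc t) h s' \<le> dual (Suc t) h (Suc s')"
      using 2 dual_mirror[OF in_That(1), of h] dual_mirror[OF in_That(2), of h]
      unfolding s'(3,4)[symmetric] by simp_all
    from step[OF strict_linear_order_dual[OF Suc.prems(1)] good_dual[OF Suc.prems(2)]
        mirror_in[OF Suc.prems(3)] s'(1) greatest this]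
    show ?thesis
      using reachable_dual[OF Suc.prems(2) _ Suc.prems(3)] by blast
  qed
qed

theorem theorem8p6:
  fixes t k :: nat and prec :: "(nat \<times> nat) set" and F' :: "(nat \<Rightarrow> nat) set"
  assumes "1 \<le> t"
    and "prec \<subseteq> T t \<times> T t" and "strict_linear_order_on (T t) prec"
    and "F' \<in> Hc t prec" and "k \<in> That t"
  shows "\<exists>F \<in> Hc_at t prec k. condition_S t prec F F'"
proof -
  obtain h' where F': "F' \<in> H t" "h' \<in> F'" and h': "good t prec h'"
    using assms(4) unfolding Hc_def good_def by blast
  obtain h n u v where h: "good t prec h" "strongly_extremal t h = k"
    and path: "increasing_path t prec (strongly_extremal t h') k n u v"
    and eq: "\<And>(C :: nat \<Rightarrow> polynomial) R. label_sum t h C R - label_sum t h' C R =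
           (\<Sum>i\<in>{1..<n}. C (u i) * (R (v i) - R (v (i + 1))))"
    using reachable_all[OF assms(3) h' assms(5), of "TYPE(polynomial)"] unfolding reachable_def by blast
  obtain F where F: "F \<in> H t" "h \<in> F"
    using H_exists[OF good_diagram[OF h(1)]] by blast
  have "F \<in> Hc_at t prec k"
    unfolding Hc_at_def Hc_def using F h H_element(3)[OF F] unfolding good_def by blast
  moreover have "condition_S t prec F F'"
    unfolding condition_S_def
  proof (intro allI impI, elim conjE)
    fix j k' assume "F' \<in> H_at t j" "F \<in> H_at t k'"
    then have jk: "strongly_extremal t h' = j" "k = k'"
      using H_element(3)[OF F'] H_element(3)[OF F] h(2) by auto
    \<comment> \<open>The remaining terms depend only on \<open>t\<close> and cancel; the minus sign
      of the label sum exchanges \<open>h\<close> and \<open>h'\<close>.\<close>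
    have "class_function t F' - class_function t F =
        label_sum t h c potential - label_sum t h' c potential"
      unfolding H_element(2)[OF F'] H_element(2)[OF F]
        tableau_function_eq[OF good_diagram[OF h(1)]] tableau_function_eq[OF good_diagram[OF h']]
      by simp
    also have "\<dots> = (\<Sum>i\<in>{1..<n}. c (u i) * r_diff (v i) (v (i + 1)))"
      unfolding eq r_diff_potential ..
    finally show "\<exists>(n::nat) (u::nat \<Rightarrow> nat) (v::nat \<Rightarrow> nat).
        1 \<le> n \<and> (\<forall>i\<in>{1..<n}. u i \<in> T t) \<and> (\<forall>i\<in>{1..n}. v i \<in> That t) \<and> v 1 = j \<and> v n = k' \<and>
        class_function t F' - class_function t F =
          (\<Sum>i\<in>{1..<n}. c (u i) * r_diff (v i) (v (i + 1))) \<and>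
        (\<forall>i. 1 \<le> i \<and> i + 1 < n \<longrightarrow> (u i, u (i + 1)) \<in> prec)"
      using path unfolding increasing_path_def jk by blast
  qed
  ultimately show ?thesis by blast
qed

end
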